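(* Let $A\in\mathbb{P}$ and $0<t<1$, and let $f:\mathbb{P}\to\mathbb{R}_+$ be the function $$f(X)=\mathrm{tr}\left(A^{\frac{1-t}{2t}}XA^{\frac{1-t}{2t}}\right)^{t}.$$ Let $\mathbb{K}$ be a compact convex subset of $\mathbb{P}$, and let $\alpha,\beta$ be positive numbers such that $\alpha I\le Y\le\beta I$ for all $Y\in\mathbb{K}\cup\{A\}$. Then for all $X\in\mathbb{K}$ $$\mathrm{cond}\left(\nabla^2 f(X)\right)\le\left(\frac{\beta}{\alpha}\right)^{3-2t}.$$
   Context: $\mathbb{P}$ is the set of $n\times n$ complex positive definite matrices, an open subset of the real vector space $\mathbb{H}$ of $n\times n$ complex Hermitian matrices, which carries the inner product $\langle X,Y\rangle=\mathrm{tr}(XY)$. $\mathbb{R}_+=[0,\infty)$. For Hermitian matrices, $X\le Y$ means $Y-X$ is positive semidefinite. $\mathrm{tr}(Z)^t$ means the trace of $Z^t$. For a smooth $f:\mathbb{P}\to\mathbb{R}$, the Hessian $\nabla^2 f(X)$ is the self-adjoint linear operator on $\mathbb{H}$ determined by $\langle\nabla^2 f(X)(Y),Z\rangle=D^2f(X)(Y,Z)$, where $D^2f(X)$ is the second Fréchet derivative. The condition number of an (invertible) operator $T$ is $\mathrm{cond}(T)=\|T\|\,\|T^{-1}\|$, with $\|\cdot\|$ the operator norm (here on $\mathbb{H}$ with the inner product $\langle X,Y\rangle=\mathrm{tr}(XY)$). *)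

theory Defs
  imports "HOL-Analysis.Analysis"
begin

section \<open>Complex matrices\<close>

definition ctranspose :: "complex^'n^'m \<Rightarrow> complex^'m^'n" where
  "ctranspose M = (\<chi> i j. cnj (M $ j $ i))"

definition hermitian :: "complex^'n^'n \<Rightarrow> bool" where
  "hermitian M \<longleftrightarrow> ctranspose M = M"

definition unitary :: "complex^'n^'n \<Rightarrow> bool" where
  "unitary U \<longleftrightarrow> U ** ctranspose U = mat 1 \<and> ctranspose U ** U = mat 1"

definition diagonal_mat :: "('n \<Rightarrow> real) \<Rightarrow> complex^'n^'n" where
  "diagonal_mat d = (\<chi> i j. if i = j then complex_of_real (d i) else 0)"

text \<open>For Hermitian \<open>M\<close> the value of \<open>quad_form M v\<close> is real, so taking real parts below
  loses no information.\<close>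

definition quad_form :: "complex^'n^'n \<Rightarrow> complex^'n \<Rightarrow> complex" where
  "quad_form M v = (\<Sum>i\<in>UNIV. cnj (v $ i) * (M *v v) $ i)"

definition pos_def :: "complex^'n^'n \<Rightarrow> bool" where
  "pos_def M \<longleftrightarrow> hermitian M \<and> (\<forall>v. v \<noteq> 0 \<longrightarrow> 0 < Re (quad_form M v))"

definition pos_semidef :: "complex^'n^'n \<Rightarrow> bool" where
  "pos_semidef M \<longleftrightarrow> hermitian M \<and> (\<forall>v. 0 \<le> Re (quad_form M v))"

definition loewner_le :: "complex^'n^'n \<Rightarrow> complex^'n^'n \<Rightarrow> bool" (infix \<open>\<preceq>\<close> 50) where
  "M \<preceq> N \<longleftrightarrow> pos_semidef (N - M)"

text \<open>Real powers of a positive definite matrix by spectral calculus. The result does not depend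
  on the chosen diagonalization, see \<open>mat_powr_eq\<close> below.\<close>

definition mat_powr :: "complex^'n^'n \<Rightarrow> real \<Rightarrow> complex^'n^'n" where
  "mat_powr M s = (THE B. \<exists>U d. unitary U \<and> (\<forall>i. 0 < d i) \<and>
     M = U ** diagonal_mat d ** ctranspose U \<and>
     B = U ** diagonal_mat (\<lambda>i. d i powr s) ** ctranspose U)"

lemma diagonal_mat_mult:
  "(W ** diagonal_mat d) $ i $ j = W $ i $ j * complex_of_real (d j)"
  "(diagonal_mat d ** W) $ i $ j = complex_of_real (d i) * W $ i $ j"
  by (simp_all add: matrix_matrix_mult_def diagonal_mat_def if_distrib if_distribR sum.delta' sum.delta
      cong: if_cong)

lemma mat_powr_eq:
  fixes U :: "complex^'n^'n"
  assumes U: "unitary U" and d: "\<And>i. 0 < d i"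
  shows "mat_powr (U ** diagonal_mat d ** ctranspose U) s =
    U ** diagonal_mat (\<lambda>i. d i powr s) ** ctranspose U"
  unfolding mat_powr_def
proof (rule the_equality)
  show "\<exists>V e. unitary V \<and> (\<forall>i. 0 < e i) \<and>
      U ** diagonal_mat d ** ctranspose U = V ** diagonal_mat e ** ctranspose V \<and>
      U ** diagonal_mat (\<lambda>i. d i powr s) ** ctranspose U =
      V ** diagonal_mat (\<lambda>i. e i powr s) ** ctranspose V"
    using U d by blast
next
  fix B
  assume "\<exists>V e. unitary V \<and> (\<forall>i. 0 < e i) \<and>
      U ** diagonal_mat d ** ctranspose U = V ** diagonal_mat e ** ctranspose V \<and>
      B = V ** diagonal_mat (\<lambda>i. e i powr s) ** ctranspose V"
  then obtain V e where V: "unitary V"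
    and eq: "U ** diagonal_mat d ** ctranspose U = V ** diagonal_mat e ** ctranspose V"
    and B: "B = V ** diagonal_mat (\<lambda>i. e i powr s) ** ctranspose V"
    by blast
  define W where "W = ctranspose V ** U"
  have UU: "ctranspose U ** U = mat 1" "U ** ctranspose U = mat 1"
    and VV: "ctranspose V ** V = mat 1" "V ** ctranspose V = mat 1"
    using U V by (auto simp: unitary_def)
  have "W ** diagonal_mat d = ctranspose V ** (U ** diagonal_mat d ** ctranspose U) ** U"
    by (simp add: W_def UU matrix_mul_assoc[symmetric])
  also have "\<dots> = (ctranspose V ** V) ** diagonal_mat e ** W"
    unfolding eq by (simp add: W_def matrix_mul_assoc)
  finally have "W ** diagonal_mat d = diagonal_mat e ** W" by (simp add: VV)
  then have ent: "W $ i $ j * complex_of_real (d j) = complex_of_real (e i) * W $ i $ j" for i j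
    by (metis diagonal_mat_mult)
  have "W $ i $ j * complex_of_real (d j powr s) = complex_of_real (e i powr s) * W $ i $ j" for i j
    using ent[of i j] by (cases "W $ i $ j = 0") auto
  then have W: "W ** diagonal_mat (\<lambda>i. d i powr s) = diagonal_mat (\<lambda>i. e i powr s) ** W"
    by (simp add: vec_eq_iff diagonal_mat_mult)
  have "U ** diagonal_mat (\<lambda>i. d i powr s) ** ctranspose U
      = (V ** ctranspose V) ** U ** diagonal_mat (\<lambda>i. d i powr s) ** ctranspose U"
    by (simp add: VV)
  also have "\<dots> = V ** (W ** diagonal_mat (\<lambda>i. d i powr s)) ** ctranspose U"
    by (simp add: W_def matrix_mul_assoc)
  also have "\<dots> = V ** diagonal_mat (\<lambda>i. e i powr s) ** ctranspose V ** (U ** ctranspose U)"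
    unfolding W by (simp add: W_def matrix_mul_assoc)
  also have "\<dots> = B" by (simp add: B UU)
  finally show "B = U ** diagonal_mat (\<lambda>i. d i powr s) ** ctranspose U" by simp
qed


section \<open>The Euclidean space of Hermitian matrices\<close>

typedef 'n herm = "{M :: complex^'n^'n. hermitian M}"
  morphisms herm_mat Herm
  by (rule exI[of _ 0]) (simp add: hermitian_def ctranspose_def vec_eq_iff)

lemma hermitian_herm_mat [simp]: "hermitian (herm_mat X)"
  using herm_mat[of X] by simp

lemma herm_mat_Herm [simp]: "hermitian M \<Longrightarrow> herm_mat (Herm M) = M"
  by (simp add: Herm_inverse)

lemma hermitian_closure [simp]:
  "hermitian 0"
  "hermitian (mat 1)"
  "hermitian M \<Longrightarrow> hermitian N \<Longrightarrow> hermitian (M + N)"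
  "hermitian M \<Longrightarrow> hermitian N \<Longrightarrow> hermitian (M - N)"
  "hermitian M \<Longrightarrow> hermitian (- M)"
  "hermitian M \<Longrightarrow> hermitian (r *\<^sub>R M)"
  by (auto simp: hermitian_def ctranspose_def vec_eq_iff mat_def)

lemma inner_eq_trace:
  assumes "hermitian M"
  shows "inner M N = Re (trace (M ** N))"
proof -
  have cnj: "cnj (M $ j $ i) = M $ i $ j" for i j
    using assms by (simp add: hermitian_def ctranspose_def vec_eq_iff)
  have h: "Re (M $ i $ j) = Re (M $ j $ i)" "Im (M $ i $ j) = - Im (M $ j $ i)" for i j
    by (simp_all flip: cnj[of j i])
  have "Re (trace (M ** N)) = (\<Sum>i\<in>UNIV. \<Sum>j\<in>UNIV. Re (M $ i $ j * N $ j $ i))"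
    by (simp add: trace_def matrix_matrix_mult_def)
  also have "\<dots> = (\<Sum>j\<in>UNIV. \<Sum>i\<in>UNIV. Re (M $ i $ j * N $ j $ i))"
    by (rule sum.swap)
  also have "\<dots> = (\<Sum>j\<in>UNIV. \<Sum>i\<in>UNIV. inner (M $ j $ i) (N $ j $ i))"
  proof (intro sum.cong refl)
    fix i j
    show "Re (M $ i $ j * N $ j $ i) = inner (M $ j $ i) (N $ j $ i)"
      using h[of i j] by (simp add: inner_complex_def)
  qed
  finally show ?thesis by (simp add: inner_vec_def)
qed

instantiation herm :: (finite) real_vector
begin

definition zero_herm :: "'a herm" where "0 = Herm 0"
definition plus_herm :: "'a herm \<Rightarrow> 'a herm \<Rightarrow> 'a herm" where
  "X + Y = Herm (herm_mat X + herm_mat Y)"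
definition minus_herm :: "'a herm \<Rightarrow> 'a herm \<Rightarrow> 'a herm" where
  "X - Y = Herm (herm_mat X - herm_mat Y)"
definition uminus_herm :: "'a herm \<Rightarrow> 'a herm" where
  "- X = Herm (- herm_mat X)"
definition scaleR_herm :: "real \<Rightarrow> 'a herm \<Rightarrow> 'a herm" where
  "r *\<^sub>R X = Herm (r *\<^sub>R herm_mat X)"

lemma herm_mat_simps [simp]:
  "herm_mat (0 :: 'a herm) = 0"
  "herm_mat (X + Y) = herm_mat X + herm_mat Y"
  "herm_mat (X - Y) = herm_mat X - herm_mat Y"
  "herm_mat (- X) = - herm_mat X"
  "herm_mat (r *\<^sub>R X) = r *\<^sub>R herm_mat X"
  for X Y :: "'a herm"
  by (simp_all add: zero_herm_def plus_herm_def minus_herm_def uminus_herm_def scaleR_herm_def)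

instance
proof
  fix X Y Z :: "'a herm" and r q :: real
  show "X + Y + Z = X + (Y + Z)" "X + Y = Y + X" "0 + X = X" "- X + X = 0" "X - Y = X + - Y"
    by (simp_all add: herm_mat_inject[symmetric])
  show "r *\<^sub>R (X + Y) = r *\<^sub>R X + r *\<^sub>R Y" "(r + q) *\<^sub>R X = r *\<^sub>R X + q *\<^sub>R X"
    "r *\<^sub>R q *\<^sub>R X = (r * q) *\<^sub>R X" "1 *\<^sub>R X = X"
    by (simp_all add: herm_mat_inject[symmetric] scaleR_add_right scaleR_add_left)
qed

end

instantiation herm :: (finite) real_inner
begin

text \<open>The trace of a product of two Hermitian matrices is real.\<close>

definition inner_herm :: "'a herm \<Rightarrow> 'a herm \<Rightarrow> real" where
  "inner X Y = Re (trace (herm_mat X ** herm_mat Y))"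
definition norm_herm :: "'a herm \<Rightarrow> real" where
  "norm X = sqrt (inner X X)" for X :: "'a herm"
definition sgn_herm :: "'a herm \<Rightarrow> 'a herm" where
  "sgn X = X /\<^sub>R norm X" for X :: "'a herm"
definition dist_herm :: "'a herm \<Rightarrow> 'a herm \<Rightarrow> real" where
  "dist X Y = norm (X - Y)" for X :: "'a herm"
definition uniformity_herm :: "('a herm \<times> 'a herm) filter" where
  "uniformity_herm = (INF e\<in>{0<..}. principal {(X, Y). dist X Y < e})"
definition open_herm :: "'a herm set \<Rightarrow> bool" where
  "open_herm U \<longleftrightarrow> (\<forall>X\<in>U. eventually (\<lambda>(X', Y). X' = X \<longrightarrow> Y \<in> U) uniformity)"

lemma inner_herm_mat: "inner X Y = inner (herm_mat X) (herm_mat Y)" for X Y :: "'a herm"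
  by (simp add: inner_herm_def inner_eq_trace)

instance
proof
  fix X Y Z :: "'a herm" and r :: real
  show "inner X Y = inner Y X"
    unfolding inner_herm_mat by (rule inner_commute)
  show "inner (X + Y) Z = inner X Z + inner Y Z"
    unfolding inner_herm_mat by (simp only: herm_mat_simps inner_add_left)
  show "inner (r *\<^sub>R X) Y = r * inner X Y"
    unfolding inner_herm_mat by (simp only: herm_mat_simps inner_scaleR_left)
  show "0 \<le> inner X X"
    unfolding inner_herm_mat by (rule inner_ge_zero)
  show "inner X X = 0 \<longleftrightarrow> X = 0"
    unfolding inner_herm_mat herm_mat_inject[symmetric]
    by (simp only: herm_mat_simps inner_eq_zero_iff)
qed (rule norm_herm_def sgn_herm_def dist_herm_def uniformity_herm_def open_herm_def)+

end

instantiation herm :: (finite) euclidean_space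
begin

definition Basis_herm :: "'a herm set" where
  "Basis_herm = Herm ` (SOME B. B \<subseteq> {M. hermitian M} \<and> pairwise orthogonal B \<and>
     (\<forall>x\<in>B. norm x = 1) \<and> finite B \<and> span B = {M. hermitian M})"

instance
proof -
  define H where "H = {M :: complex^'a^'a. hermitian M}"
  define B where "B = (SOME B. B \<subseteq> H \<and> pairwise orthogonal B \<and> (\<forall>x\<in>B. norm x = 1) \<and>
    finite B \<and> span B = H)"
  have "subspace H" by (simp add: subspace_def H_def)
  then have "\<exists>B. B \<subseteq> H \<and> pairwise orthogonal B \<and> (\<forall>x\<in>B. norm x = 1) \<and> finite B \<and> span B = H"
    by (metis orthonormal_basis_subspace independent_imp_finite)
  from someI_ex[OF this, folded B_def]
  have B: "B \<subseteq> H" "pairwise orthogonal B" "\<And>x. x \<in> B \<Longrightarrow> norm x = 1" "finite B" "span B = H"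
    by auto
  have Bas: "(Basis :: 'a herm set) = Herm ` B"
    by (simp add: Basis_herm_def B_def H_def)
  have mat: "herm_mat (Herm b) = b" if "b \<in> B" for b
    using that B(1) by (auto simp: H_def)
  show "OFCLASS('a herm, euclidean_space_class)"
  proof
    have "(mat 1 :: complex^'a^'a) \<noteq> 0"
      by (auto simp: vec_eq_iff mat_def)
    moreover have "mat 1 \<in> H" by (simp add: H_def)
    ultimately have "B \<noteq> {}" using B(5) by auto
    then show "(Basis :: 'a herm set) \<noteq> {}" by (simp add: Bas)
    show "finite (Basis :: 'a herm set)" by (simp add: Bas B)
  next
    fix u v :: "'a herm"
    assume "u \<in> Basis" "v \<in> Basis"
    then obtain b c where b: "b \<in> B" "u = Herm b" and c: "c \<in> B" "v = Herm c"
      by (auto simp: Bas)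
    have "u = v \<longleftrightarrow> b = c" using b c mat by metis
    moreover have "inner b c = (if b = c then 1 else 0)"
      using B(2,3) b c by (auto simp: pairwise_def orthogonal_def dot_square_norm)
    ultimately show "inner u v = (if u = v then 1 else 0)"
      using b c mat by (simp add: inner_herm_mat)
  next
    fix x :: "'a herm"
    have "x = 0" if *: "\<forall>u\<in>Basis. inner x u = 0"
    proof -
      have "orthogonal (herm_mat x) b" if "b \<in> B" for b
        using * that mat by (auto simp: Bas inner_herm_mat orthogonal_def)
      moreover have "herm_mat x \<in> span B" by (simp add: B(5) H_def)
      ultimately have "orthogonal (herm_mat x) (herm_mat x)"
        using orthogonal_to_span by blast
      then show ?thesis by (simp add: orthogonal_def herm_mat_inject[symmetric])
    qed
    then show "(\<forall>u\<in>Basis. inner x u = 0) \<longleftrightarrow> x = 0" by auto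
  qed
qed

end

definition PD :: "'n::finite herm set" where
  "PD = {X. pos_def (herm_mat X)}"


section \<open>Hessian and condition number\<close>

definition frechet_blinfun ::
    "('a::real_normed_vector \<Rightarrow> 'b::real_normed_vector) \<Rightarrow> 'a \<Rightarrow> 'a \<Rightarrow>\<^sub>L 'b" where
  "frechet_blinfun f X = Blinfun (frechet_derivative f (at X))"

definition second_frechet_derivative ::
    "('a::real_normed_vector \<Rightarrow> 'b::real_normed_vector) \<Rightarrow> 'a \<Rightarrow> 'a \<Rightarrow> 'a \<Rightarrow> 'b" where
  "second_frechet_derivative f X Y Z =
     blinfun_apply (frechet_derivative (frechet_blinfun f) (at X) Y) Z"

definition hessian :: "('a::euclidean_space \<Rightarrow> real) \<Rightarrow> 'a \<Rightarrow> 'a \<Rightarrow> 'a" where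
  "hessian f X = (THE T. linear T \<and> (\<forall>Y Z. inner (T Y) Z = second_frechet_derivative f X Y Z))"

lemma second_frechet_derivative_eq:
  assumes "open S" "X \<in> S"
    and f': "\<And>W. W \<in> S \<Longrightarrow> (f has_derivative blinfun_apply (f' W)) (at W)"
    and f'': "(f' has_derivative f'') (at X)"
  shows "second_frechet_derivative f X Y Z = blinfun_apply (f'' Y) Z"
proof -
  have "frechet_blinfun f W = f' W" if "W \<in> S" for W
    unfolding frechet_blinfun_def frechet_derivative_at[OF f'[OF that], symmetric]
    by (rule blinfun_apply_inverse)
  then have "(frechet_blinfun f has_derivative f'') (at X)"
    by (intro has_derivative_transform_within_open[OF f'' assms(1,2)]) simp
  from frechet_derivative_at[OF this] show ?thesis
    by (simp add: second_frechet_derivative_def)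
qed

lemma hessian_inner:
  fixes f :: "'a::euclidean_space \<Rightarrow> real"
  assumes "open S" "X \<in> S"
    and f': "\<And>W. W \<in> S \<Longrightarrow> (f has_derivative blinfun_apply (f' W)) (at W)"
    and f'': "(f' has_derivative f'') (at X)"
  shows "linear (hessian f X)" "inner (hessian f X Y) Z = blinfun_apply (f'' Y) Z"
proof -
  let ?P = "\<lambda>T. linear T \<and> (\<forall>Y Z. inner (T Y) Z = blinfun_apply (f'' Y) Z)"
  define T where "T Y = (\<Sum>b\<in>Basis. blinfun_apply (f'' Y) b *\<^sub>R b)" for Y
  have lin: "linear f''" using f'' by (rule has_derivative_linear)
  have "linear T"
    by (rule linearI) (simp_all add: T_def linear_add[OF lin] linear_scale[OF lin]
        blinfun.add_left blinfun.scaleR_left scaleR_add_left sum.distrib scaleR_sum_right)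
  moreover have "inner (T Y) Z = blinfun_apply (f'' Y) Z" for Y Z
  proof -
    have "blinfun_apply (f'' Y) Z = blinfun_apply (f'' Y) (\<Sum>b\<in>Basis. inner Z b *\<^sub>R b)"
      by (simp add: euclidean_representation)
    also have "\<dots> = (\<Sum>b\<in>Basis. inner Z b * blinfun_apply (f'' Y) b)"
      by (simp only: blinfun.sum_right blinfun.scaleR_right real_scaleR_def)
    also have "\<dots> = inner (T Y) Z"
      by (simp add: T_def inner_sum_left mult.commute inner_commute[of Z])
    finally show ?thesis by simp
  qed
  ultimately have T: "?P T" by blast
  have uniq: "T' = T" if "?P T'" for T'
    using T that by (metis ext vector_eq_rdot)
  have D2: "second_frechet_derivative f X Y Z = blinfun_apply (f'' Y) Z" for Y Z
    using assms by (rule second_frechet_derivative_eq)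
  have "hessian f X = T"
    unfolding hessian_def D2 using T uniq by (rule the_equality)
  with T show "linear (hessian f X)" "inner (hessian f X Y) Z = blinfun_apply (f'' Y) Z"
    by auto
qed

text \<open>A non-invertible operator has infinite condition number; without this convention
  \<open>inv T\<close> would be unspecified in that case.\<close>

definition condition_number :: "('a::real_normed_vector \<Rightarrow> 'a) \<Rightarrow> ereal" where
  "condition_number T = (if bij T then ereal (onorm T * onorm (inv T)) else \<infinity>)"

end

theory Submission
  imports Defs
begin

text \<open>
  Put \<open>s = 1 - t\<close>, \<open>C = A\<^sup>r\<close> with \<open>r = (1 - t) / (2 t)\<close>, and \<open>Z = C X C\<close>. The gradient of \<open>f\<close> at
  \<open>X\<close> is \<open>t C Z\<^sup>-\<^sup>s C\<close>, so the Hessian comes from the derivative of \<open>Z \<mapsto> Z\<^sup>-\<^sup>s\<close>. In an eigenbasis of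
  \<open>Z\<close> with eigenvalues \<open>d\<close> this derivative multiplies the entry \<open>(i, j)\<close> by \<open>- k(d i, d j)\<close>, where
  \<open>- k\<close> is the divided difference of \<open>x \<mapsto> x\<^sup>-\<^sup>s\<close> (\<open>has_derivative_mat_powr_neg\<close>,
  \<open>hessian_trace_power\<close>). Hence
  \<open>- \<langle>\<nabla>\<^sup>2f(X) Y, Y\<rangle> = t \<Sum>\<^sub>i\<^sub>j k(d i, d j) |y\<^sub>i\<^sub>j|\<^sup>2\<close> with \<open>y\<close> the matrix of \<open>C Y C\<close> in that
  basis, and the Hessian is negative definite.

  Bounding \<open>k\<close> by its extreme values and the norm of \<open>C Y C\<close> by that of \<open>Y\<close> separately would only
  give the exponent \<open>(4 - 3t) / t\<close>, because \<open>C\<close> is then counted twice. The sharp exponent comes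
  from the integral representation
  \<open>k(a, b) = c \<integral> l\<^sup>-\<^sup>s / ((l + a) (l + b)) dl\<close> over \<open>l > 0\<close> (\<open>integral_stieltjes2\<close>). It turns the
  quadratic form into an average over \<open>l\<close> of \<open>tr(R Y R Y)\<close>, where
  \<open>R = C (l + Z)\<inverse> C = (l C\<^sup>-\<^sup>2 + X)\<inverse>\<close>; here \<open>A\<close> and \<open>X\<close> occur additively. The hypotheses put the
  eigenvalues of \<open>R\<inverse>\<close> between \<open>l \<beta>\<^sup>-\<^sup>2\<^sup>r + \<alpha>\<close> and \<open>l \<alpha>\<^sup>-\<^sup>2\<^sup>r + \<beta>\<close>
  (\<open>resolvent_congruence_bounds\<close>). Inserting these scalars and integrating back
  (\<open>neg_power_kernel_sum_mono\<close>) shows that the quadratic form lies between its values for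
  \<open>1 \<times> 1\<close> matrices, namely \<open>t (1 - t) \<alpha>\<^sup>s \<beta>\<^sup>-\<^sup>s\<^sup>-\<^sup>1\<close> and \<open>t (1 - t) \<beta>\<^sup>s \<alpha>\<^sup>-\<^sup>s\<^sup>-\<^sup>1\<close> times \<open>\<parallel>Y\<parallel>\<^sup>2\<close>. The
  quotient of the two constants is \<open>(\<beta> / \<alpha>)\<^sup>2\<^sup>s\<^sup>+\<^sup>1\<close>, and \<open>2s + 1 = 3 - 2t\<close>.
\<close>

section \<open>Matrix algebra and the trace inner product\<close>

lemma ctranspose_ctranspose [simp]: "ctranspose (ctranspose M) = M"
  by (simp add: ctranspose_def vec_eq_iff)

lemma ctranspose_add: "ctranspose (M + N) = ctranspose M + ctranspose N"
  by (simp add: ctranspose_def vec_eq_iff)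

lemma ctranspose_scaleR: "ctranspose (r *\<^sub>R M) = r *\<^sub>R ctranspose M"
  by (simp add: ctranspose_def vec_eq_iff)

lemma ctranspose_mult: "ctranspose (M ** N) = ctranspose N ** ctranspose M"
  by (simp add: ctranspose_def vec_eq_iff matrix_matrix_mult_def mult.commute)

lemma ctranspose_diagonal_mat [simp]: "ctranspose (diagonal_mat d) = diagonal_mat d"
  by (auto simp add: ctranspose_def diagonal_mat_def vec_eq_iff)

lemma hermitian_ctranspose: "hermitian M \<Longrightarrow> ctranspose M = M"
  by (simp add: hermitian_def)

lemma hermitian_congruence: "hermitian M \<Longrightarrow> hermitian (E ** M ** ctranspose E)"
  by (simp add: hermitian_def ctranspose_mult matrix_mul_assoc)

lemma hermitian_diagonal_mat: "hermitian (diagonal_mat d)"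
  by (simp add: hermitian_def)

lemma unitary_ctranspose: "unitary U \<Longrightarrow> unitary (ctranspose U)"
  by (simp add: unitary_def)

lemma unitary_cancel:
  assumes "unitary U"
  shows "U ** ctranspose U = mat 1" "ctranspose U ** U = mat 1"
    "ctranspose U ** (U ** M) = M" "U ** (ctranspose U ** M) = M"
  using assms by (simp_all add: unitary_def matrix_mul_assoc)

lemma scaleR_matrix_mult:
  fixes M :: "complex^'n^'m"
  shows "(r *\<^sub>R M) ** N = r *\<^sub>R (M ** N)" "M ** (r *\<^sub>R N) = r *\<^sub>R (M ** N)"
  by (simp_all add: vec_eq_iff matrix_matrix_mult_def scaleR_sum_right)

lemma matrix_mult_diff:
  fixes M :: "complex^'n^'m"
  shows "(M - M') ** N = M ** N - M' ** N" "M ** (N - N') = M ** N - M ** N'"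
  by (simp_all add: vec_eq_iff matrix_matrix_mult_def algebra_simps sum_subtractf)

lemma matrix_mult_add:
  fixes M :: "complex^'n^'m"
  shows "(M + M') ** N = M ** N + M' ** N" "M ** (N + N') = M ** N + M ** N'"
  by (simp_all add: vec_eq_iff matrix_matrix_mult_def algebra_simps sum.distrib)

lemma inner_cvec: "inner v w = Re (\<Sum>i\<in>UNIV. cnj (v $ i) * w $ i)" for v w :: "complex^'n"
  by (simp add: inner_vec_def inner_complex_def)

lemma inner_cmat: "inner M N = Re (\<Sum>i\<in>UNIV. \<Sum>j\<in>UNIV. cnj (M $ i $ j) * N $ i $ j)"
  for M N :: "complex^'n^'m"
  by (simp add: inner_vec_def inner_complex_def)

lemma inner_mult_left: "inner (E ** M) N = inner M (ctranspose E ** N)"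
  for E :: "complex^'n^'m" and M :: "complex^'k^'n"
proof -
  have "(\<Sum>i\<in>UNIV. \<Sum>j\<in>UNIV. cnj ((E ** M) $ i $ j) * N $ i $ j)
     = (\<Sum>i\<in>UNIV. \<Sum>j\<in>UNIV. \<Sum>k\<in>UNIV. cnj (E $ i $ k) * cnj (M $ k $ j) * N $ i $ j)"
    by (simp add: matrix_matrix_mult_def sum_distrib_right)
  also have "\<dots> = (\<Sum>i\<in>UNIV. \<Sum>k\<in>UNIV. \<Sum>j\<in>UNIV. cnj (E $ i $ k) * cnj (M $ k $ j) * N $ i $ j)"
    by (intro sum.cong refl sum.swap)
  also have "\<dots> = (\<Sum>k\<in>UNIV. \<Sum>i\<in>UNIV. \<Sum>j\<in>UNIV. cnj (E $ i $ k) * cnj (M $ k $ j) * N $ i $ j)"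
    by (rule sum.swap)
  also have "\<dots> = (\<Sum>k\<in>UNIV. \<Sum>j\<in>UNIV. \<Sum>i\<in>UNIV. cnj (E $ i $ k) * cnj (M $ k $ j) * N $ i $ j)"
    by (intro sum.cong refl sum.swap)
  also have "\<dots> = (\<Sum>k\<in>UNIV. \<Sum>j\<in>UNIV. cnj (M $ k $ j) * (ctranspose E ** N) $ k $ j)"
    by (simp add: matrix_matrix_mult_def ctranspose_def sum_distrib_left mult_ac)
  finally show ?thesis unfolding inner_cmat by (rule arg_cong)
qed

lemma inner_ctranspose: "inner (ctranspose M) (ctranspose N) = inner M N"
  for M N :: "complex^'n^'m"
proof -
  have "(\<Sum>i\<in>UNIV. \<Sum>j\<in>UNIV. inner (ctranspose M $ i $ j) (ctranspose N $ i $ j))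
    = (\<Sum>i\<in>UNIV. \<Sum>j\<in>UNIV. inner (M $ j $ i) (N $ j $ i))"
    by (simp add: ctranspose_def inner_complex_def)
  also have "\<dots> = (\<Sum>j\<in>UNIV. \<Sum>i\<in>UNIV. inner (M $ j $ i) (N $ j $ i))"
    by (rule sum.swap)
  finally show ?thesis by (simp add: inner_vec_def)
qed

lemma norm_ctranspose [simp]: "norm (ctranspose M) = norm M" for M :: "complex^'n^'m"
  by (simp add: norm_eq_sqrt_inner inner_ctranspose)

lemma inner_mult_right: "inner (M ** E) N = inner M (N ** ctranspose E)"
  for E :: "complex^'n^'m" and M :: "complex^'m^'k"
  by (subst (1 2) inner_ctranspose[symmetric]) (simp add: ctranspose_mult inner_mult_left)

lemma norm_unitary_mult:
  assumes "unitary U"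
  shows "norm (U ** M) = norm M" "norm (M ** U) = norm M"
  using assms
  by (simp_all add: norm_eq_sqrt_inner inner_mult_left[of U] inner_mult_right[of M U] unitary_cancel
      flip: matrix_mul_assoc)

section \<open>The spectral theorem for Hermitian matrices\<close>

text \<open>
  The form \<open>(x, y) \<mapsto> \<langle>x, T y\<rangle>\<close> may be degenerate, so the discriminant argument has to treat
  \<open>\<langle>y, T y\<rangle> = 0\<close> separately. The restriction to a subspace allows its use on the orthogonal
  complement of a set of eigenvectors.
\<close>

lemma psd_form_Cauchy_Schwarz:
  fixes T :: "'a::real_inner \<Rightarrow> 'a"
  assumes lin: "linear T" and sub: "subspace S"
    and sym: "\<And>x y. x \<in> S \<Longrightarrow> y \<in> S \<Longrightarrow> inner x (T y) = inner y (T x)"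
    and pos: "\<And>x. x \<in> S \<Longrightarrow> 0 \<le> inner x (T x)"
    and x: "x \<in> S" and y: "y \<in> S"
  shows "(inner x (T y))\<^sup>2 \<le> inner x (T x) * inner y (T y)"
proof -
  let ?a = "inner x (T x)" and ?b = "inner x (T y)" and ?c = "inner y (T y)"
  have q: "0 \<le> ?a + 2 * r * ?b + r\<^sup>2 * ?c" for r
  proof -
    have "x + r *\<^sub>R y \<in> S" using sub x y by (simp add: subspace_add subspace_scale)
    from pos[OF this] show ?thesis
      using sym[OF x y]
      by (simp add: linear_add[OF lin] linear_scale[OF lin] inner_add_left inner_add_right
          power2_eq_square algebra_simps)
  qed
  show ?thesis
  proof (cases "?c = 0")
    case True
    have "?b = 0"
    proof (rule ccontr)
      assume "?b \<noteq> 0"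
      then show False using q[of "- (?a + 1) / (2 * ?b)"] True by (simp add: field_simps)
    qed
    then show ?thesis using True by simp
  next
    case False
    with pos[OF y] have "?c > 0" by simp
    then show ?thesis using q[of "- ?b / ?c"] by (simp add: field_simps power2_eq_square)
  qed
qed

definition cinner :: "complex^'n \<Rightarrow> complex^'n \<Rightarrow> complex" where
  "cinner v w = (\<Sum>i\<in>UNIV. cnj (v $ i) * w $ i)"

lemma Re_cinner: "Re (cinner v w) = inner v w"
  by (simp add: cinner_def inner_cvec)

lemma cinner_scale_left: "cinner (c *s v) w = cnj c * cinner v w"
  by (simp add: cinner_def sum_distrib_left mult_ac)

lemma cinner_add_right: "cinner v (w + w') = cinner v w + cinner v w'"
  by (simp add: cinner_def sum.distrib algebra_simps)

lemma cinner_scaleR_right: "cinner v (r *\<^sub>R w) = r *\<^sub>R cinner v w"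
  by (simp add: cinner_def scaleR_sum_right)

lemma cinner_commute: "cinner w v = cnj (cinner v w)"
  by (simp add: cinner_def mult.commute)

lemma cinner_self: "cinner v v = complex_of_real ((norm v)\<^sup>2)"
proof -
  have "cnj (cinner v v) = cinner v v" by (metis cinner_commute)
  then have "Im (cinner v v) = 0" by (simp add: complex_eq_iff)
  moreover have "Re (cinner v v) = (norm v)\<^sup>2" by (simp add: Re_cinner power2_norm_eq_inner)
  ultimately show ?thesis by (simp add: complex_eq_iff)
qed

lemma cinner_matrix_mult: "cinner v (M *v w) = cinner (ctranspose M *v v) w"
proof -
  have "cinner v (M *v w) = (\<Sum>i\<in>UNIV. \<Sum>j\<in>UNIV. cnj (v $ i) * (M $ i $ j * w $ j))"
    by (simp add: cinner_def matrix_vector_mult_def sum_distrib_left)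
  also have "\<dots> = (\<Sum>j\<in>UNIV. \<Sum>i\<in>UNIV. cnj (v $ i) * (M $ i $ j * w $ j))"
    by (rule sum.swap)
  also have "\<dots> = cinner (ctranspose M *v v) w"
    by (simp add: cinner_def matrix_vector_mult_def ctranspose_def sum_distrib_left mult_ac)
  finally show ?thesis .
qed

lemma bounded_linear_cinner: "bounded_linear (cinner v)"
  by (rule linear_conv_bounded_linear[THEN iffD1])
     (simp add: linear_iff cinner_add_right cinner_scaleR_right)

lemma bounded_linear_matrix_vector: "bounded_linear ((*v) M)" for M :: "complex^'n^'m"
  by (rule linear_conv_bounded_linear[THEN iffD1])
     (simp add: linear_iff vec_eq_iff matrix_vector_mult_def scaleR_sum_right algebra_simps
        sum.distrib)

text \<open>
  The quadratic form of \<open>M\<close> attains its maximum \<open>\<mu>\<close> on the unit sphere of the complex orthogonal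
  complement \<open>S\<close> of \<open>B\<close>, which \<open>M\<close> leaves invariant. Then \<open>\<mu> - M\<close> is positive semidefinite on
  \<open>S\<close> and its form vanishes at the maximizer \<open>v\<close>, so by the Cauchy--Schwarz inequality
  \<open>(\<mu> - M) v = 0\<close>.
\<close>

lemma hermitian_eigenvector_in_complement:
  fixes M :: "complex^'n^'n"
  assumes M: "hermitian M" and fin: "finite B" and card: "card B < CARD('n)"
    and eig: "\<And>b. b \<in> B \<Longrightarrow> \<exists>\<mu>. M *v b = complex_of_real \<mu> *s b"
  shows "\<exists>v \<mu>. norm v = 1 \<and> M *v v = complex_of_real \<mu> *s v \<and> (\<forall>b\<in>B. cinner b v = 0)"
proof -
  define S where "S = {v. \<forall>b\<in>B. cinner b v = 0}"
  have S: "subspace S"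
    by (auto simp: S_def subspace_def cinner_add_right cinner_scaleR_right cinner_def[of _ 0])
  have inv: "M *v v \<in> S" if "v \<in> S" for v
    using that eig M by (force simp: S_def cinner_matrix_mult hermitian_ctranspose cinner_scale_left)
  have sym: "inner x (M *v y) = inner y (M *v x)" for x y
    using M by (metis Re_cinner cinner_matrix_mult hermitian_ctranspose inner_commute)
  \<comment> \<open>A vector that is real orthogonal to \<open>b\<close> and to \<open>\<i> b\<close> is complex orthogonal to \<open>b\<close>, and
    \<open>2 card B\<close> vectors cannot span the real space of dimension \<open>2 CARD('n)\<close>.\<close>
  let ?B = "B \<union> (\<lambda>b. \<i> *s b) ` B"
  have "dim ?B \<le> card ?B" using fin by (intro dim_le_card span_superset) simp
  also have "\<dots> \<le> card B + card B"
    by (meson card_Un_le card_image_le fin add_left_mono order_trans)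
  also have "\<dots> < DIM(complex^'n)" using card by simp
  finally obtain u where u: "u \<noteq> 0" "\<And>y. y \<in> span ?B \<Longrightarrow> orthogonal u y"
    using orthogonal_to_subspace_exists by blast
  have "cinner b u = 0" if "b \<in> B" for b
  proof -
    have "orthogonal u b" "orthogonal u (\<i> *s b)" using u(2) that by (auto intro: span_base)
    then have "Re (cinner b u) = 0" "Re (cinner (\<i> *s b) u) = 0"
      by (simp_all only: Re_cinner orthogonal_def inner_commute)
    then show ?thesis by (simp add: cinner_scale_left complex_eq_iff)
  qed
  then have uS: "u \<in> S" by (simp add: S_def)
  define C where "C = sphere 0 1 \<inter> S"
  have "closed S"
  proof -
    have "S = (\<Inter>b\<in>B. cinner b -` {0})" by (auto simp: S_def)
    then show ?thesis
      using linear_continuous_at[OF bounded_linear_cinner]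
      by (auto intro!: closed_INT continuous_closed_vimage)
  qed
  then have "compact C" unfolding C_def by (intro compact_Int_closed compact_sphere)
  moreover have "u /\<^sub>R norm u \<in> C" using u(1) uS S by (simp add: C_def subspace_scale)
  moreover have "continuous_on C (\<lambda>v. inner v (M *v v))"
    by (intro continuous_intros linear_continuous_on bounded_linear_matrix_vector)
  ultimately obtain v where v: "v \<in> C" and max: "\<And>w. w \<in> C \<Longrightarrow> inner w (M *v w) \<le> inner v (M *v v)"
    using continuous_attains_sup[of C] by blast
  define \<mu> where "\<mu> = inner v (M *v v)"
  define T where "T w = \<mu> *\<^sub>R w - M *v w" for w
  have vS: "v \<in> S" "norm v = 1" using v by (auto simp: C_def)
  have T: "linear T"
    unfolding T_def
    by (intro linear_compose_sub linear_scaleR bounded_linear.linear[OF bounded_linear_matrix_vector])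
  have TS: "T v \<in> S" using vS(1) S inv by (simp add: T_def subspace_diff subspace_scale)
  have pos: "0 \<le> inner w (T w)" if "w \<in> S" for w
  proof (cases "w = 0")
    case False
    have "w /\<^sub>R norm w \<in> C" using that S False by (simp add: C_def subspace_scale)
    from max[OF this] have "inner w (M *v w) / (norm w)\<^sup>2 \<le> \<mu>"
      using bounded_linear.linear[OF bounded_linear_matrix_vector, of M]
      by (simp add: \<mu>_def linear_scale power2_eq_square field_simps)
    then show ?thesis using False
      by (simp add: T_def inner_diff_right field_simps power2_norm_eq_inner)
  qed (simp add: T_def)
  have "(inner (T v) (T v))\<^sup>2 \<le> inner (T v) (T (T v)) * inner v (T v)"
  proof (rule psd_form_Cauchy_Schwarz[OF T S _ pos TS vS(1)])
    show "inner x (T y) = inner y (T x)" for x y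
      using sym[of x y] inner_commute[of x y] by (simp add: T_def inner_diff_right)
  qed
  also have "inner v (T v) = 0"
    using vS by (simp add: T_def \<mu>_def inner_diff_right flip: power2_norm_eq_inner)
  finally have "T v = 0" by simp
  then have "M *v v = complex_of_real \<mu> *s v"
    by (simp add: T_def vec_eq_iff scaleR_conv_of_real[symmetric])
  then show ?thesis using vS by (auto simp: S_def)
qed

lemma hermitian_eigenbasis:
  fixes M :: "complex^'n^'n"
  assumes "hermitian M" and "k \<le> CARD('n)"
  shows "\<exists>B. finite B \<and> card B = k \<and> (\<forall>b\<in>B. \<exists>\<mu>. M *v b = complex_of_real \<mu> *s b) \<and>
     (\<forall>b\<in>B. \<forall>c\<in>B. cinner b c = (if b = c then 1 else 0))"
  using assms(2)
proof (induction k)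
  case 0
  then show ?case by (intro exI[of _ "{}"]) auto
next
  case (Suc k)
  then obtain B where B: "finite B" "card B = k"
    "\<And>b. b \<in> B \<Longrightarrow> \<exists>\<mu>. M *v b = complex_of_real \<mu> *s b"
    "\<And>b c. b \<in> B \<Longrightarrow> c \<in> B \<Longrightarrow> cinner b c = (if b = c then 1 else 0)"
    by (metis Suc_leD)
  obtain v \<mu> where v: "norm v = 1" "M *v v = complex_of_real \<mu> *s v" "\<And>b. b \<in> B \<Longrightarrow> cinner b v = 0"
    using hermitian_eigenvector_in_complement[OF assms(1) B(1) _ B(3)] Suc.prems B(2) by force
  have "cinner v v = 1" using v(1) by (simp add: cinner_self)
  then have "v \<notin> B" using v(3) by force
  moreover have "cinner v b = 0" if "b \<in> B" for b
    using v(3)[OF that] by (subst cinner_commute) simp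
  ultimately show ?case
    using B v \<open>cinner v v = 1\<close> by (intro exI[of _ "insert v B"]) auto
qed

text \<open>
  As many orthonormal eigenvectors as the dimension, taken as columns, form the unitary matrix.
\<close>

theorem hermitian_spectral:
  fixes M :: "complex^'n^'n"
  assumes M: "hermitian M"
  obtains U d where "unitary U" "M = U ** diagonal_mat d ** ctranspose U"
proof -
  obtain B where B: "finite B" "card B = CARD('n)"
    "\<And>b. b \<in> B \<Longrightarrow> \<exists>\<mu>. M *v b = complex_of_real \<mu> *s b"
    "\<And>b c. b \<in> B \<Longrightarrow> c \<in> B \<Longrightarrow> cinner b c = (if b = c then 1 else 0)"
    using hermitian_eigenbasis[OF M order_refl] by blast
  obtain h :: "'n \<Rightarrow> complex^'n" where h: "bij_betw h UNIV B"
    using B(1,2) by (metis finite_same_card_bij finite_class.finite_UNIV)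
  have "\<exists>\<mu>. M *v h j = complex_of_real \<mu> *s h j" for j
    using B(3)[of "h j"] h by (auto simp: bij_betw_def)
  then obtain d where d: "\<And>j. M *v h j = complex_of_real (d j) *s h j"
    by metis
  define U :: "complex^'n^'n" where "U = (\<chi> i j. h j $ i)"
  have "(ctranspose U ** U) $ i $ j = mat 1 $ i $ j" for i j
  proof -
    have "(ctranspose U ** U) $ i $ j = cinner (h i) (h j)"
      by (simp add: U_def cinner_def matrix_matrix_mult_def ctranspose_def)
    also have "\<dots> = (if i = j then 1 else 0)"
      using B(4)[of "h i" "h j"] h by (auto simp: bij_betw_def inj_on_def)
    finally show ?thesis by (simp add: mat_def)
  qed
  then have 1: "ctranspose U ** U = mat 1" by (simp add: vec_eq_iff)
  then have U: "unitary U" by (simp add: unitary_def matrix_left_right_inverse)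
  have "(M ** U) $ i $ j = (U ** diagonal_mat d) $ i $ j" for i j
  proof -
    have "(M ** U) $ i $ j = (M *v h j) $ i"
      by (simp add: U_def matrix_matrix_mult_def matrix_vector_mult_def)
    then show ?thesis by (simp add: d diagonal_mat_mult) (simp add: U_def mult.commute)
  qed
  then have "M ** U = U ** diagonal_mat d" by (simp add: vec_eq_iff)
  then have "M = U ** diagonal_mat d ** ctranspose U"
    using U by (metis matrix_mul_assoc matrix_mul_rid unitary_def)
  with U show ?thesis using that by blast
qed

section \<open>Divided differences of the power with exponent \<open>-s\<close>\<close>

text \<open>
  The negative of the divided difference of \<open>x \<mapsto> x\<^sup>-\<^sup>s\<close> at \<open>a\<close> and \<open>b\<close>, continued to the diagonal
  by the derivative; the sign makes it positive.
\<close>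

definition neg_power_kernel :: "real \<Rightarrow> real \<Rightarrow> real \<Rightarrow> real" where
  "neg_power_kernel s a b =
     (if a = b then s * a powr (- s - 1) else (a powr - s - b powr - s) / (b - a))"

text \<open>
  The integrands of \<open>\<integral> l\<^sup>-\<^sup>s / (l + a) dl\<close> and \<open>\<integral> l\<^sup>-\<^sup>s / ((l + a) (l + b)) dl\<close> over the positive half
  line. The first integral is a multiple of \<open>a\<^sup>-\<^sup>s\<close>. The constant has the value \<open>\<pi> / sin (\<pi> s)\<close>, but
  only its positivity matters, so it is kept as the integral for \<open>a = 1\<close>.
\<close>

definition stieltjes1 :: "real \<Rightarrow> real \<Rightarrow> real \<Rightarrow> real" where
  "stieltjes1 s a l = indicator {0<..} l * (l powr - s / (l + a))"

definition stieltjes2 :: "real \<Rightarrow> real \<Rightarrow> real \<Rightarrow> real \<Rightarrow> real" where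
  "stieltjes2 s a b l = indicator {0<..} l * (l powr - s / ((l + a) * (l + b)))"

abbreviation stieltjes_const :: "real \<Rightarrow> real" where
  "stieltjes_const s \<equiv> integral\<^sup>L lborel (stieltjes1 s 1)"

lemma borel_measurable_stieltjes [measurable]:
  "stieltjes1 s a \<in> borel_measurable borel" "stieltjes2 s a b \<in> borel_measurable borel"
  unfolding stieltjes1_def stieltjes2_def by measurable

lemma integrable_stieltjes1_one:
  assumes "0 < s" "s < 1"
  shows "integrable lborel (stieltjes1 s 1)"
proof -
  have 1: "integrable lebesgue (\<lambda>l. indicator {0..1} l * l powr - s)"
    using nonnegative_absolutely_integrable_1[OF integrable_on_powr_from_0[of "- s" 1]] assms
    by (simp add: set_integrable_def)
  have 2: "integrable lebesgue (\<lambda>l. indicator {1..} l * l powr (- s - 1))"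
  proof -
    have "(\<lambda>l. l powr (- s - 1)) integrable_on {1..}"
      using has_integral_powr_to_inf[of "- s - 1" 1] assms by (auto simp: integrable_on_def)
    from nonnegative_absolutely_integrable_1[OF this] show ?thesis
      by (simp add: set_integrable_def)
  qed
  have "integrable lebesgue (stieltjes1 s 1)"
  proof (rule Bochner_Integration.integrable_bound[OF Bochner_Integration.integrable_add[OF 1 2]])
    show "stieltjes1 s 1 \<in> borel_measurable lebesgue"
      by (rule measurable_completion) simp
    show "AE l in lebesgue. norm (stieltjes1 s 1 l)
        \<le> norm (indicator {0..1} l * l powr - s + indicator {1..} l * l powr (- s - 1))"
    proof (rule AE_I2)
      fix l :: real
      have p: "l powr - s / (l + 1) \<le> l powr - s" if "l > 0"
        using that by (simp add: divide_le_eq)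
      have q: "l powr - s / (l + 1) \<le> l powr (- s - 1)" if "l > 0"
        using that by (simp add: powr_diff frac_le)
      show "norm (stieltjes1 s 1 l)
        \<le> norm (indicator {0..1} l * l powr - s + indicator {1..} l * l powr (- s - 1))"
      proof (cases "l > 0")
        case True
        then show ?thesis using p q by (auto simp: stieltjes1_def indicator_def add_increasing2)
      next
        case False
        then show ?thesis by (simp add: stieltjes1_def)
      qed
    qed
  qed
  then show ?thesis by (subst (asm) integrable_completion) simp_all
qed

lemma stieltjes1_scale:
  assumes "a > 0"
  shows "stieltjes1 s a (0 + a * l) = a powr (- s - 1) * stieltjes1 s 1 l"
proof -
  have "(a * l) powr - s / (a * l + a) = a powr (- s - 1) * (l powr - s / (l + 1))" if "l > 0"
  proof -
    have "a * l + a = a * (l + 1)" by (simp add: algebra_simps)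
    then show ?thesis using assms that by (simp add: powr_mult powr_diff)
  qed
  then show ?thesis using assms by (auto simp: stieltjes1_def indicator_def zero_less_mult_iff)
qed

lemma integrable_stieltjes1:
  assumes "0 < s" "s < 1" "a > 0"
  shows "integrable lborel (stieltjes1 s a)"
  using lborel_integrable_real_affine_iff[of a "stieltjes1 s a" 0] assms
  by (simp only: stieltjes1_scale) (simp add: integrable_stieltjes1_one)

lemma integral_stieltjes1:
  assumes "a > 0"
  shows "integral\<^sup>L lborel (stieltjes1 s a) = stieltjes_const s * a powr - s"
proof -
  have "integral\<^sup>L lborel (stieltjes1 s a) = a * (a powr (- s - 1) * stieltjes_const s)"
    using lborel_integral_real_affine[of a "stieltjes1 s a" 0] assms
    by (simp only: stieltjes1_scale) simp
  then show ?thesis using assms by (simp add: powr_diff)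
qed

lemma stieltjes_const_pos:
  assumes "0 < s" "s < 1"
  shows "stieltjes_const s > 0"
proof -
  have "0 < 2 powr - s / 3 * measure lborel {1..2::real}" by simp
  also have "\<dots> = (\<integral>l. indicator {1..2::real} l * (2 powr - s / 3) \<partial>lborel)" by simp
  also have "\<dots> \<le> stieltjes_const s"
  proof (rule integral_mono)
    show "integrable lborel (\<lambda>l::real. indicator {1..2} l * (2 powr - s / 3))" by simp
    show "indicator {1..2} l * (2 powr - s / 3) \<le> stieltjes1 s 1 l" for l :: real
    proof (cases "l \<in> {1..2}")
      case True
      then have "2 powr - s \<le> l powr - s" using assms by (intro powr_mono2') auto
      then have "2 powr - s / 3 \<le> l powr - s / (l + 1)" using True by (intro frac_le) auto
      then show ?thesis using True by (simp add: stieltjes1_def)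
    qed (auto simp: stieltjes1_def indicator_def)
  qed (rule integrable_stieltjes1_one[OF assms])
  finally show ?thesis .
qed

lemma stieltjes2_nonneg: "a > 0 \<Longrightarrow> b > 0 \<Longrightarrow> 0 \<le> stieltjes2 s a b l"
  by (simp add: stieltjes2_def indicator_def)

lemma stieltjes2_le:
  assumes "0 < a'" "a' \<le> a" "0 < b'" "b' \<le> b"
  shows "stieltjes2 s a b l \<le> stieltjes2 s a' b' l"
  using assms by (auto simp: stieltjes2_def indicator_def intro!: divide_left_mono mult_mono)

lemma integrable_stieltjes2:
  assumes "0 < s" "s < 1" "a > 0" "b > 0"
  shows "integrable lborel (stieltjes2 s a b)"
proof (rule Bochner_Integration.integrable_bound)
  show "integrable lborel (\<lambda>l. stieltjes1 s a l / b)" using integrable_stieltjes1[OF assms(1-3)] by simp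
  show "AE l in lborel. norm (stieltjes2 s a b l) \<le> norm (stieltjes1 s a l / b)"
  proof (rule AE_I2)
    fix l :: real
    show "norm (stieltjes2 s a b l) \<le> norm (stieltjes1 s a l / b)"
      using assms by (auto simp: stieltjes1_def stieltjes2_def indicator_def intro!: divide_left_mono mult_left_mono)
  qed
qed simp

text \<open>
  The resolvent identity \<open>1/(l + b) - 1/(l + c) = (c - b) / ((l + b) (l + c))\<close> produces the factor
  \<open>b - c\<close>. The Lipschitz property is used twice: it extends the integral representation to
  \<open>a = b\<close>, and it controls the remainder in the derivative of the matrix power.
\<close>

lemma stieltjes2_lipschitz:
  assumes s: "0 < s" "s < 1" and m: "0 < m" "m \<le> a" "m \<le> b" "m \<le> c"
  shows "\<bar>integral\<^sup>L lborel (stieltjes2 s a b) - integral\<^sup>L lborel (stieltjes2 s a c)\<bar>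
     \<le> (integral\<^sup>L lborel (stieltjes2 s m m) / m) * \<bar>b - c\<bar>"
proof -
  have int: "integrable lborel (stieltjes2 s x y)" if "m \<le> x" "m \<le> y" for x y
    using integrable_stieltjes2 that m s by simp
  have pt: "norm (stieltjes2 s a b l - stieltjes2 s a c l) \<le> stieltjes2 s m m l * (\<bar>b - c\<bar> / m)" for l
  proof (cases "l > 0")
    case True
    have "stieltjes2 s a b l - stieltjes2 s a c l = stieltjes2 s a b l * ((c - b) / (l + c))"
    proof -
      have "p / (u * v) - p / (u * w) = p / (u * v) * ((w - v) / w)" if "u > 0" "v > 0" "w > 0" for p u v w :: real
        using that by (simp add: field_simps)
      from this[of "l + a" "l + b" "l + c" "l powr - s"] show ?thesis
        using True m by (simp add: stieltjes2_def)
    qed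
    also have "norm \<dots> = stieltjes2 s a b l * (\<bar>b - c\<bar> / (l + c))"
      using True m stieltjes2_nonneg[of a b s l] by (simp add: abs_mult abs_divide abs_minus_commute)
    also have "\<dots> \<le> stieltjes2 s m m l * (\<bar>b - c\<bar> / m)"
      using True m by (intro mult_mono stieltjes2_le divide_left_mono stieltjes2_nonneg) auto
    finally show ?thesis .
  qed (simp add: stieltjes2_def)
  have "\<bar>integral\<^sup>L lborel (stieltjes2 s a b) - integral\<^sup>L lborel (stieltjes2 s a c)\<bar>
     = norm (\<integral>l. stieltjes2 s a b l - stieltjes2 s a c l \<partial>lborel)"
    using int m by simp
  also have "\<dots> \<le> (\<integral>l. stieltjes2 s m m l * (\<bar>b - c\<bar> / m) \<partial>lborel)"
    using int m by (intro Bochner_Integration.integral_norm_bound_integral pt) auto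
  finally show ?thesis by (simp add: field_simps)
qed

lemma integral_stieltjes2_distinct:
  assumes s: "0 < s" "s < 1" and ab: "a > 0" "b > 0" "a \<noteq> b"
  shows "integral\<^sup>L lborel (stieltjes2 s a b) = stieltjes_const s * neg_power_kernel s a b"
proof -
  have "(b - a) * stieltjes2 s a b l = stieltjes1 s a l - stieltjes1 s b l" for l
  proof -
    have "(v - u) * (p / (u * v)) = p / u - p / v" if "u > 0" "v > 0" for p u v :: real
      using that by (simp add: field_simps)
    from this[of "l + a" "l + b" "l powr - s"] show ?thesis
      using ab by (auto simp: stieltjes1_def stieltjes2_def indicator_def)
  qed
  then have "(\<integral>l. (b - a) * stieltjes2 s a b l \<partial>lborel) = (\<integral>l. stieltjes1 s a l - stieltjes1 s b l \<partial>lborel)"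
    by simp
  also have "\<dots> = stieltjes_const s * (a powr - s - b powr - s)"
    unfolding Bochner_Integration.integral_diff[OF integrable_stieltjes1[OF s ab(1)]
        integrable_stieltjes1[OF s ab(2)]] integral_stieltjes1[OF ab(1)] integral_stieltjes1[OF ab(2)]
    by (simp add: right_diff_distrib)
  finally have "(b - a) * integral\<^sup>L lborel (stieltjes2 s a b) = stieltjes_const s * (a powr - s - b powr - s)"
    by simp
  then show ?thesis
    using ab by (simp add: neg_power_kernel_def nonzero_eq_divide_eq mult.commute)
qed

text \<open>
  For \<open>a \<noteq> b\<close> this is a partial fraction decomposition. The diagonal case follows by continuity,
  since for \<open>x \<rightarrow> a\<close> the right-hand side is a difference quotient.
\<close>

theorem integral_stieltjes2:
  assumes s: "0 < s" "s < 1" and ab: "a > 0" "b > 0"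
  shows "integral\<^sup>L lborel (stieltjes2 s a b) = stieltjes_const s * neg_power_kernel s a b"
proof (cases "a = b")
  case True
  let ?J = "\<lambda>x. integral\<^sup>L lborel (stieltjes2 s a x)"
  let ?M = "integral\<^sup>L lborel (stieltjes2 s (a/2) (a/2)) / (a/2)"
  have "?J \<midarrow>a\<rightarrow> ?J a"
  proof (rule Lim_null[THEN iffD2], rule Lim_null_comparison)
    show "\<forall>\<^sub>F x in at a. norm (?J x - ?J a) \<le> ?M * \<bar>x - a\<bar>"
      unfolding eventually_at
    proof (intro exI[of _ "a/2"] conjI ballI impI)
      fix x assume "x \<noteq> a \<and> dist x a < a/2"
      then have "\<bar>x - a\<bar> < a/2" by (simp add: dist_real_def)
      then have "a/2 \<le> x" by linarith
      then show "norm (?J x - ?J a) \<le> ?M * \<bar>x - a\<bar>"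
        using stieltjes2_lipschitz[OF s, of "a/2" a x a] ab by simp
    qed (use ab in simp)
    show "((\<lambda>x. ?M * \<bar>x - a\<bar>) \<longlongrightarrow> 0) (at a)"
      using ab by (auto intro!: tendsto_eq_intros)
  qed
  moreover have "?J \<midarrow>a\<rightarrow> stieltjes_const s * (s * a powr (- s - 1))"
  proof (rule Lim_transform_eventually)
    have "((\<lambda>x. x powr - s) has_real_derivative - s * a powr (- s - 1)) (at a)"
      using ab by (auto intro!: derivative_eq_intros)
    then have "((\<lambda>x. (x powr - s - a powr - s) / (x - a)) \<longlongrightarrow> - s * a powr (- s - 1)) (at a)"
      by (simp add: has_field_derivative_iff)
    from tendsto_mult[OF tendsto_const[of "- stieltjes_const s"] this]
    show "((\<lambda>x. - stieltjes_const s * ((x powr - s - a powr - s) / (x - a)))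
        \<longlongrightarrow> stieltjes_const s * (s * a powr (- s - 1))) (at a)" by simp
    show "\<forall>\<^sub>F x in at a. - stieltjes_const s * ((x powr - s - a powr - s) / (x - a)) = ?J x"
      unfolding eventually_at
    proof (intro exI[of _ a] conjI ballI impI)
      fix x assume "x \<noteq> a \<and> dist x a < a"
      then have "x > 0" "a \<noteq> x" by (auto simp: dist_real_def)
      then have "?J x = stieltjes_const s * neg_power_kernel s a x"
        by (intro integral_stieltjes2_distinct s ab)
      then show "- stieltjes_const s * ((x powr - s - a powr - s) / (x - a)) = ?J x"
        using \<open>a \<noteq> x\<close> by (simp add: neg_power_kernel_def field_simps)
    qed (use ab in simp)
  qed
  ultimately have "?J a = stieltjes_const s * (s * a powr (- s - 1))"
    by (rule tendsto_unique[OF trivial_limit_at])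
  then show ?thesis using True by (simp add: neg_power_kernel_def)
qed (use integral_stieltjes2_distinct s ab in blast)

lemma neg_power_kernel_mult: "(b - a) * neg_power_kernel s a b = a powr - s - b powr - s"
  by (simp add: neg_power_kernel_def)

lemma neg_power_kernel_lipschitz:
  assumes s: "0 < s" "s < 1" and m: "0 < m"
  obtains L where "0 \<le> L"
    "\<And>a b c. m \<le> a \<Longrightarrow> m \<le> b \<Longrightarrow> m \<le> c \<Longrightarrow>
      \<bar>neg_power_kernel s a b - neg_power_kernel s a c\<bar> \<le> L * \<bar>b - c\<bar>"
proof
  let ?K = "stieltjes_const s" and ?I = "integral\<^sup>L lborel (stieltjes2 s m m)"
  have K: "?K > 0" using s by (rule stieltjes_const_pos)
  have "0 \<le> ?I" using m by (intro integral_nonneg_AE AE_I2 stieltjes2_nonneg)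
  then show "0 \<le> ?I / m / ?K" using K m by simp
  show "\<bar>neg_power_kernel s a b - neg_power_kernel s a c\<bar> \<le> ?I / m / ?K * \<bar>b - c\<bar>"
    if "m \<le> a" "m \<le> b" "m \<le> c" for a b c
  proof -
    have "\<bar>?K * neg_power_kernel s a b - ?K * neg_power_kernel s a c\<bar> \<le> ?I / m * \<bar>b - c\<bar>"
      using stieltjes2_lipschitz[OF s m that] that m s by (simp add: integral_stieltjes2)
    also have "?K * neg_power_kernel s a b - ?K * neg_power_kernel s a c
       = ?K * (neg_power_kernel s a b - neg_power_kernel s a c)" by (simp add: algebra_simps)
    finally have "\<bar>neg_power_kernel s a b - neg_power_kernel s a c\<bar> * ?K \<le> ?I / m * \<bar>b - c\<bar>"
      using K by (simp only: abs_mult abs_of_pos mult.commute)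
    then have "\<bar>neg_power_kernel s a b - neg_power_kernel s a c\<bar> \<le> ?I / m * \<bar>b - c\<bar> / ?K"
      by (simp only: pos_le_divide_eq[OF K])
    then show ?thesis by simp
  qed
qed

text \<open>
  A comparison of rational functions of \<open>l\<close> is multiplied by \<open>l\<^sup>-\<^sup>s\<close> and integrated. In this way
  estimates for resolvents become estimates for the kernel.
\<close>

theorem neg_power_kernel_sum_mono:
  fixes c a b :: "'i \<Rightarrow> real" and c' a' b' :: "'j \<Rightarrow> real"
  assumes s: "0 < s" "s < 1"
    and pos: "\<And>i. i \<in> I \<Longrightarrow> 0 < a i \<and> 0 < b i" "\<And>j. j \<in> J \<Longrightarrow> 0 < a' j \<and> 0 < b' j"
    and le: "\<And>l. 0 < l \<Longrightarrow> (\<Sum>i\<in>I. c i / ((l + a i) * (l + b i))) \<le> (\<Sum>j\<in>J. c' j / ((l + a' j) * (l + b' j)))"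
  shows "(\<Sum>i\<in>I. c i * neg_power_kernel s (a i) (b i)) \<le> (\<Sum>j\<in>J. c' j * neg_power_kernel s (a' j) (b' j))"
proof -
  let ?K = "stieltjes_const s"
  have K: "?K > 0" using s by (rule stieltjes_const_pos)
  have "(\<integral>l. (\<Sum>i\<in>I. c i * stieltjes2 s (a i) (b i) l) \<partial>lborel)
      \<le> (\<integral>l. (\<Sum>j\<in>J. c' j * stieltjes2 s (a' j) (b' j) l) \<partial>lborel)"
  proof (rule integral_mono)
    fix l :: real
    show "(\<Sum>i\<in>I. c i * stieltjes2 s (a i) (b i) l) \<le> (\<Sum>j\<in>J. c' j * stieltjes2 s (a' j) (b' j) l)"
    proof (cases "l > 0")
      case True
      from mult_left_mono[OF le[OF True], of "l powr - s"] show ?thesis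
        using True by (simp add: stieltjes2_def sum_distrib_left mult_ac)
    qed (simp add: stieltjes2_def)
  qed (use s pos in \<open>auto intro!: Bochner_Integration.integrable_sum integrable_stieltjes2\<close>)
  also have "(\<integral>l. (\<Sum>i\<in>I. c i * stieltjes2 s (a i) (b i) l) \<partial>lborel)
      = (\<Sum>i\<in>I. c i * (?K * neg_power_kernel s (a i) (b i)))"
    using s pos by (simp add: Bochner_Integration.integral_sum integrable_stieltjes2 integral_stieltjes2)
  also have "(\<integral>l. (\<Sum>i\<in>J. c' i * stieltjes2 s (a' i) (b' i) l) \<partial>lborel)
      = (\<Sum>i\<in>J. c' i * (?K * neg_power_kernel s (a' i) (b' i)))"
    using s pos by (simp add: Bochner_Integration.integral_sum integrable_stieltjes2 integral_stieltjes2)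
  finally have "?K * (\<Sum>i\<in>I. c i * neg_power_kernel s (a i) (b i))
      \<le> ?K * (\<Sum>j\<in>J. c' j * neg_power_kernel s (a' j) (b' j))"
    by (simp add: sum_distrib_left mult_ac)
  then show ?thesis using K by simp
qed

section \<open>Positive definite matrices and the derivative of a negative power\<close>

lemma quad_form_spectral:
  assumes "unitary U"
  shows "Re (quad_form (U ** diagonal_mat d ** ctranspose U) v) =
    (\<Sum>i\<in>UNIV. d i * (norm ((ctranspose U *v v) $ i))\<^sup>2)"
proof -
  define w where "w = ctranspose U *v v"
  have "quad_form (U ** diagonal_mat d ** ctranspose U) v = cinner v (U *v (diagonal_mat d *v w))"
    by (simp add: quad_form_def cinner_def w_def matrix_vector_mul_assoc matrix_mul_assoc)
  also have "\<dots> = cinner w (diagonal_mat d *v w)"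
    by (simp add: cinner_matrix_mult w_def)
  also have "\<dots> = (\<Sum>i\<in>UNIV. cnj (w $ i) * (complex_of_real (d i) * w $ i))"
    by (simp add: cinner_def matrix_vector_mult_def diagonal_mat_def if_distrib if_distribR
        sum.delta' sum.delta cong: if_cong)
  also have "Re \<dots> = (\<Sum>i\<in>UNIV. d i * (norm (w $ i))\<^sup>2)"
    by (simp add: cmod_power2) (simp add: power2_eq_square algebra_simps)
  finally show ?thesis by (simp add: w_def)
qed

lemma quad_form_eigenvector:
  assumes "unitary U"
  shows "Re (quad_form (U ** diagonal_mat d ** ctranspose U) (U *v axis k 1)) = d k"
proof -
  have "ctranspose U *v (U *v axis k 1) = axis k 1"
    using assms by (simp add: matrix_vector_mul_assoc unitary_def)
  then show ?thesis
    by (simp add: quad_form_spectral[OF assms] axis_def if_distrib if_distribR sum.delta' cong: if_cong)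
qed

lemma hermitian_spectral_form: "hermitian (U ** diagonal_mat d ** ctranspose U)"
  by (simp add: hermitian_congruence hermitian_diagonal_mat)

lemma pos_semidef_spectral_iff:
  assumes "unitary U"
  shows "pos_semidef (U ** diagonal_mat d ** ctranspose U) \<longleftrightarrow> (\<forall>i. 0 \<le> d i)"
proof
  assume "pos_semidef (U ** diagonal_mat d ** ctranspose U)"
  then show "\<forall>i. 0 \<le> d i"
    using quad_form_eigenvector[OF assms, of d] by (metis pos_semidef_def)
qed (simp add: pos_semidef_def hermitian_spectral_form quad_form_spectral[OF assms] sum_nonneg)

lemma unitary_mult_vec_nonzero:
  assumes "unitary U" "v \<noteq> 0"
  shows "U *v v \<noteq> 0"
proof
  assume "U *v v = 0"
  then have "ctranspose U *v (U *v v) = 0" by simp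
  then show False using assms by (simp add: matrix_vector_mul_assoc unitary_def)
qed

lemma pos_def_spectral_iff:
  assumes U: "unitary U"
  shows "pos_def (U ** diagonal_mat d ** ctranspose U) \<longleftrightarrow> (\<forall>i. 0 < d i)"
proof
  assume "pos_def (U ** diagonal_mat d ** ctranspose U)"
  then show "\<forall>i. 0 < d i"
    using quad_form_eigenvector[OF U, of d] unitary_mult_vec_nonzero[OF U]
    by (metis axis_eq_0_iff pos_def_def zero_neq_one)
next
  assume d: "\<forall>i. 0 < d i"
  have "0 < (\<Sum>i\<in>UNIV. d i * (norm ((ctranspose U *v v) $ i))\<^sup>2)" if "v \<noteq> 0" for v
  proof -
    have "ctranspose U *v v \<noteq> 0"
      using unitary_mult_vec_nonzero[OF unitary_ctranspose[OF U] that] .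
    then obtain i where "(ctranspose U *v v) $ i \<noteq> 0" by (auto simp: vec_eq_iff)
    then show ?thesis using d by (intro sum_pos2[of _ i]) (auto simp: less_imp_le)
  qed
  then show "pos_def (U ** diagonal_mat d ** ctranspose U)"
    by (simp add: pos_def_def hermitian_spectral_form quad_form_spectral[OF U])
qed

lemma pos_def_spectral:
  assumes "pos_def M"
  obtains U d where "unitary U" "\<And>i. 0 < d i" "M = U ** diagonal_mat d ** ctranspose U"
  using assms hermitian_spectral[of M] pos_def_spectral_iff by (metis pos_def_def)

lemma diagonal_mat_diff: "diagonal_mat d - diagonal_mat e = diagonal_mat (\<lambda>i. d i - e i)"
  by (simp add: diagonal_mat_def vec_eq_iff)

lemma scalar_spectral_form:
  fixes U :: "complex^'n^'n"
  assumes "unitary U"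
  shows "r *\<^sub>R mat 1 = U ** diagonal_mat (\<lambda>_. r) ** ctranspose U"
proof -
  have "diagonal_mat (\<lambda>_. r) = (r *\<^sub>R mat 1 :: complex^'n^'n)"
    by (simp add: diagonal_mat_def mat_def vec_eq_iff of_real_def)
  then show ?thesis using assms by (simp add: scaleR_matrix_mult unitary_def)
qed

lemma loewner_eigenvalue_bounds:
  assumes "unitary U"
  shows "r *\<^sub>R mat 1 \<preceq> U ** diagonal_mat d ** ctranspose U \<longleftrightarrow> (\<forall>i. r \<le> d i)"
    and "U ** diagonal_mat d ** ctranspose U \<preceq> r *\<^sub>R mat 1 \<longleftrightarrow> (\<forall>i. d i \<le> r)"
  unfolding loewner_le_def scalar_spectral_form[OF assms]
    matrix_mult_diff[symmetric] diagonal_mat_diff pos_semidef_spectral_iff[OF assms]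
  by simp_all

definition hadamard :: "('n \<Rightarrow> 'm \<Rightarrow> real) \<Rightarrow> complex^'m^'n \<Rightarrow> complex^'m^'n" where
  "hadamard k M = (\<chi> i j. complex_of_real (k i j) * M $ i $ j)"

lemma linear_hadamard: "linear (hadamard k)"
  by (auto simp: linear_iff hadamard_def vec_eq_iff algebra_simps scaleR_conv_of_real)

lemma norm_cmat_le_sum: "norm M \<le> (\<Sum>i\<in>UNIV. \<Sum>j\<in>UNIV. norm (M $ i $ j))" for M :: "complex^'n^'m"
proof -
  have "norm M \<le> (\<Sum>i\<in>UNIV. norm (M $ i))"
    by (simp add: norm_vec_def[of M] L2_set_le_sum)
  also have "\<dots> \<le> (\<Sum>i\<in>UNIV. \<Sum>j\<in>UNIV. norm (M $ i $ j))"
    by (intro sum_mono) (simp add: norm_vec_def L2_set_le_sum)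
  finally show ?thesis .
qed

lemma norm_entry_le: "norm (M $ i $ j) \<le> norm M" for M :: "complex^'n^'m"
  using Finite_Cartesian_Product.norm_nth_le[of M i] Finite_Cartesian_Product.norm_nth_le[of "M $ i" j] by linarith

text \<open>
  Two Hermitian matrices need not share an eigenbasis, but their difference is explicit when its
  rows are expressed in an eigenbasis of one and its columns in an eigenbasis of the other. As the
  same unitary matrices diagonalize all powers, this identity also describes differences of powers.
\<close>

lemma mixed_eigenbasis_diff:
  assumes U: "unitary U" and V: "unitary V"
  shows "(ctranspose U ** (V ** diagonal_mat e ** ctranspose V - U ** diagonal_mat d ** ctranspose U) ** V) $ i $ j
    = complex_of_real (e j - d i) * (ctranspose U ** V) $ i $ j"
proof -
  have "ctranspose U ** (V ** diagonal_mat e ** ctranspose V - U ** diagonal_mat d ** ctranspose U) ** V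
     = (ctranspose U ** V) ** diagonal_mat e - diagonal_mat d ** (ctranspose U ** V)"
    using U V by (simp add: matrix_mult_diff unitary_cancel flip: matrix_mul_assoc)
  then show ?thesis by (simp only:) (simp add: diagonal_mat_mult algebra_simps)
qed

text \<open>
  Let \<open>H\<close> be the difference of the two matrices. If all \<open>d k\<close> were further than \<open>\<parallel>H\<parallel>\<close> from \<open>e j\<close>,
  then by the previous identity the \<open>j\<close>-th column of \<open>U\<^sup>* H V\<close> would be longer than \<open>\<parallel>H\<parallel>\<close>, because
  the \<open>j\<close>-th column of \<open>U\<^sup>* V\<close> is a unit vector.
\<close>

lemma eigenvalue_perturbation:
  fixes U V :: "complex^'n^'n"
  assumes U: "unitary U" and V: "unitary V"
  obtains k where
    "\<bar>e j - d k\<bar> \<le> norm (V ** diagonal_mat e ** ctranspose V - U ** diagonal_mat d ** ctranspose U)"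
proof -
  let ?H = "V ** diagonal_mat e ** ctranspose V - U ** diagonal_mat d ** ctranspose U"
  let ?N = "ctranspose U ** ?H ** V" and ?W = "ctranspose U ** V"
  have col: "(\<Sum>k\<in>UNIV. (norm (M $ k $ j))\<^sup>2) = (norm (ctranspose M $ j))\<^sup>2" for M :: "complex^'n^'n"
    by (simp add: ctranspose_def norm_vec_def L2_set_def sum_nonneg)
  have "(\<Sum>k\<in>UNIV. (norm (M $ k $ j))\<^sup>2) = Re ((ctranspose M ** M) $ j $ j)" for M :: "complex^'n^'n"
    by (simp add: matrix_matrix_mult_def ctranspose_def cmod_power2) (simp add: power2_eq_square)
  then have "(\<Sum>k\<in>UNIV. (norm (?W $ k $ j))\<^sup>2) = Re ((ctranspose ?W ** ?W) $ j $ j)" .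
  also have "ctranspose ?W ** ?W = mat 1"
    using U V by (simp add: ctranspose_mult unitary_cancel flip: matrix_mul_assoc)
  finally have W: "(\<Sum>k\<in>UNIV. (norm (?W $ k $ j))\<^sup>2) = 1" by (simp add: mat_def)
  have "(\<Sum>k\<in>UNIV. (e j - d k)\<^sup>2 * (norm (?W $ k $ j))\<^sup>2) = (\<Sum>k\<in>UNIV. (norm (?N $ k $ j))\<^sup>2)"
    by (simp add: mixed_eigenbasis_diff[OF U V] norm_mult power_mult_distrib flip: of_real_diff)
  also have "\<dots> \<le> (norm ?N)\<^sup>2"
    unfolding col by (metis norm_ctranspose norm_ge_zero Finite_Cartesian_Product.norm_nth_le power_mono)
  also have "\<dots> = (norm ?H)\<^sup>2"
    by (simp only: norm_unitary_mult U V unitary_ctranspose)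
  finally have le: "(\<Sum>k\<in>UNIV. (e j - d k)\<^sup>2 * (norm (?W $ k $ j))\<^sup>2) \<le> (norm ?H)\<^sup>2" .
  have "\<exists>k. \<bar>e j - d k\<bar> \<le> norm ?H"
  proof (rule ccontr)
    assume "\<not> ?thesis"
    then have gt: "norm ?H < \<bar>e j - d k\<bar>" for k by (simp add: not_le)
    have sq: "(norm ?H)\<^sup>2 < (e j - d k)\<^sup>2" for k
      using gt[of k] by (metis norm_ge_zero power2_abs power_strict_mono zero_less_numeral)
    obtain k where k: "norm (?W $ k $ j) \<noteq> 0"
      using W by (cases "\<forall>k. norm (?W $ k $ j) = 0") auto
    have "(\<Sum>k\<in>UNIV. (norm ?H)\<^sup>2 * (norm (?W $ k $ j))\<^sup>2)
        < (\<Sum>k\<in>UNIV. (e j - d k)\<^sup>2 * (norm (?W $ k $ j))\<^sup>2)"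
    proof (rule sum_strict_mono_ex1)
      show "\<forall>k\<in>UNIV. (norm ?H)\<^sup>2 * (norm (?W $ k $ j))\<^sup>2 \<le> (e j - d k)\<^sup>2 * (norm (?W $ k $ j))\<^sup>2"
        by (intro ballI mult_right_mono less_imp_le[OF sq]) simp
      show "\<exists>k\<in>UNIV. (norm ?H)\<^sup>2 * (norm (?W $ k $ j))\<^sup>2 < (e j - d k)\<^sup>2 * (norm (?W $ k $ j))\<^sup>2"
        using sq[of k] k by (intro bexI[of _ k] mult_strict_right_mono) auto
    qed simp
    with le W show False by (simp flip: sum_distrib_left)
  qed
  then show ?thesis using that by blast
qed

lemma pos_def_open_ball:
  fixes Z :: "complex^'n^'n"
  assumes "pos_def Z"
  obtains r where "r > 0" "\<And>Z'. hermitian Z' \<Longrightarrow> norm (Z' - Z) < r \<Longrightarrow> pos_def Z'"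
proof -
  obtain U d where U: "unitary U" and d: "\<And>i. 0 < d i" and Z: "Z = U ** diagonal_mat d ** ctranspose U"
    using pos_def_spectral[OF assms] by blast
  define r where "r = Min (range d)"
  have r: "r > 0" "\<And>i. r \<le> d i" using d by (auto simp: r_def)
  show ?thesis
  proof (rule that[OF r(1)])
    fix Z' assume "hermitian Z'" and lt: "norm (Z' - Z) < r"
    then obtain V e where V: "unitary V" and Z': "Z' = V ** diagonal_mat e ** ctranspose V"
      using hermitian_spectral by blast
    have "0 < e j" for j
    proof -
      obtain k where "\<bar>e j - d k\<bar> \<le> norm (Z' - Z)" using eigenvalue_perturbation[OF U V] Z Z' by metis
      then show ?thesis using lt r(2)[of k] by linarith
    qed
    then show "pos_def Z'" by (simp add: Z' pos_def_spectral_iff[OF V])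
  qed
qed

text \<open>
  The Daleckii--Krein formula for the derivative of \<open>Z \<mapsto> Z\<^sup>-\<^sup>s\<close> at \<open>Z = U diag(d) U\<^sup>*\<close> in the
  direction \<open>H\<close>. It takes a diagonalization instead of \<open>Z\<close> as its argument, to avoid a choice.
\<close>

definition neg_powr_derivative ::
    "real \<Rightarrow> complex^'n^'n \<Rightarrow> ('n \<Rightarrow> real) \<Rightarrow> complex^'n^'n \<Rightarrow> complex^'n^'n" where
  "neg_powr_derivative s U d H =
     - (U ** hadamard (\<lambda>i j. neg_power_kernel s (d i) (d j)) (ctranspose U ** H ** U) ** ctranspose U)"

lemma linear_neg_powr_derivative: "linear (neg_powr_derivative s U d)"
  by (simp add: linear_iff neg_powr_derivative_def linear_add[OF linear_hadamard]
      linear_scale[OF linear_hadamard] matrix_mult_add scaleR_matrix_mult)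

text \<open>
  Let \<open>H = Z' - Z\<close> and let \<open>\<kappa>\<close> be the kernel. In the mixed eigenbasis both the increment of the
  power and its linearization are, up to sign, sums over an index \<open>k\<close> of the products
  \<open>h\<^sub>i\<^sub>k W\<^sub>k\<^sub>j\<close>, with the coefficients \<open>\<kappa>(d i, e j)\<close> and \<open>\<kappa>(d i, d k)\<close>. The Lipschitz property
  bounds the difference of these coefficients by \<open>L |d k - e j|\<close>, and \<open>(e j - d k) W\<^sub>k\<^sub>j\<close> is again an
  entry of \<open>H\<close> in the mixed basis. So each term is quadratic in \<open>H\<close>.
\<close>

lemma neg_powr_remainder:
  fixes U V :: "complex^'n^'n"
  assumes U: "unitary U" and V: "unitary V"
    and d: "\<And>i. m \<le> d i" and e: "\<And>i. m \<le> e i" and m: "0 < m"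
    and L: "0 \<le> L" "\<And>a b c. m \<le> a \<Longrightarrow> m \<le> b \<Longrightarrow> m \<le> c \<Longrightarrow>
      \<bar>neg_power_kernel s a b - neg_power_kernel s a c\<bar> \<le> L * \<bar>b - c\<bar>"
    and Z: "Z = U ** diagonal_mat d ** ctranspose U" and Z': "Z' = V ** diagonal_mat e ** ctranspose V"
  shows "norm (mat_powr Z' (- s) - mat_powr Z (- s) - neg_powr_derivative s U d (Z' - Z))
     \<le> real (CARD('n))^3 * L * (norm (Z' - Z))\<^sup>2"
proof -
  define H where "H = Z' - Z"
  define W where "W = ctranspose U ** V"
  define h where "h = ctranspose U ** H ** U"
  define N where "N = ctranspose U ** H ** V"
  define R where "R = mat_powr Z' (- s) - mat_powr Z (- s) - neg_powr_derivative s U d H"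
  let ?k = "neg_power_kernel s"
  have pos: "0 < d i" "0 < e i" for i using d[of i] e[of i] m by linarith+
  have Zs: "mat_powr Z (- s) = U ** diagonal_mat (\<lambda>i. d i powr - s) ** ctranspose U"
    and Zs': "mat_powr Z' (- s) = V ** diagonal_mat (\<lambda>i. e i powr - s) ** ctranspose V"
    unfolding Z Z' by (rule mat_powr_eq; simp add: U V pos)+
  have N: "N $ i $ j = complex_of_real (e j - d i) * W $ i $ j" for i j
    unfolding N_def H_def W_def Z Z' by (rule mixed_eigenbasis_diff[OF U V])
  have hW: "h ** W = N"
    using U by (simp add: h_def W_def N_def unitary_cancel flip: matrix_mul_assoc)
  have ent: "(ctranspose U ** R ** V) $ i $ j
      = (\<Sum>k\<in>UNIV. complex_of_real (?k (d i) (d k) - ?k (d i) (e j)) * (h $ i $ k * W $ k $ j))" for i j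
  proof -
    have "ctranspose U ** R ** V = ctranspose U ** (mat_powr Z' (- s) - mat_powr Z (- s)) ** V
       + hadamard (\<lambda>i j. ?k (d i) (d j)) h ** W"
      using U by (simp add: R_def neg_powr_derivative_def h_def W_def matrix_mult_diff matrix_mult_add
          unitary_cancel flip: matrix_mul_assoc)
    moreover have "(ctranspose U ** (mat_powr Z' (- s) - mat_powr Z (- s)) ** V) $ i $ j
       = complex_of_real (e j powr - s - d i powr - s) * W $ i $ j"
      unfolding Zs Zs' W_def by (rule mixed_eigenbasis_diff[OF U V])
    moreover have "\<dots> = - (complex_of_real (?k (d i) (e j)) * N $ i $ j)"
      unfolding N using neg_power_kernel_mult[of "e j" "d i" s]
      by (metis (no_types, opaque_lifting) minus_diff_eq mult.assoc mult.commute mult_minus_left of_real_minus of_real_mult)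
    moreover have "N $ i $ j = (\<Sum>k\<in>UNIV. h $ i $ k * W $ k $ j)"
      unfolding hW[symmetric] by (simp add: matrix_matrix_mult_def)
    moreover have "(hadamard (\<lambda>i j. ?k (d i) (d j)) h ** W) $ i $ j
       = (\<Sum>k\<in>UNIV. complex_of_real (?k (d i) (d k)) * (h $ i $ k * W $ k $ j))"
      by (simp add: matrix_matrix_mult_def hadamard_def mult_ac)
    ultimately show ?thesis
      by (simp add: left_diff_distrib sum_subtractf sum_distrib_left)
  qed
  have "norm ((ctranspose U ** R ** V) $ i $ j) \<le> real CARD('n) * (L * (norm H)\<^sup>2)" for i j
  proof -
    have "norm (complex_of_real (?k (d i) (d k) - ?k (d i) (e j)) * (h $ i $ k * W $ k $ j)) \<le> L * (norm H)\<^sup>2" for k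
    proof -
      have "norm (complex_of_real (?k (d i) (d k) - ?k (d i) (e j)) * (h $ i $ k * W $ k $ j))
         = \<bar>?k (d i) (d k) - ?k (d i) (e j)\<bar> * (norm (h $ i $ k) * norm (W $ k $ j))"
        by (simp only: norm_mult norm_of_real)
      also have "\<dots> \<le> L * \<bar>d k - e j\<bar> * (norm (h $ i $ k) * norm (W $ k $ j))"
        using L(2)[of "d i" "d k" "e j"] d e by (intro mult_right_mono) auto
      also have "\<dots> = L * (norm (h $ i $ k) * norm (N $ k $ j))"
        by (simp only: N norm_mult norm_of_real abs_minus_commute[of "d k"] mult_ac)
      also have "\<dots> \<le> L * (norm h * norm N)"
        using L(1) by (intro mult_left_mono mult_mono norm_entry_le) auto
      also have "norm h = norm H"
        unfolding h_def using norm_unitary_mult U unitary_ctranspose by metis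
      also have "norm N = norm H"
        unfolding N_def using norm_unitary_mult U V unitary_ctranspose by metis
      finally show ?thesis by (simp add: power2_eq_square)
    qed
    then show ?thesis unfolding ent
      by (intro order_trans[OF norm_sum] order_trans[OF sum_bounded_above]) auto
  qed
  then have "norm (ctranspose U ** R ** V) \<le> (\<Sum>i\<in>(UNIV::'n set). \<Sum>j\<in>(UNIV::'n set). real CARD('n) * (L * (norm H)\<^sup>2))"
    by (intro order_trans[OF norm_cmat_le_sum] sum_mono)
  also have "norm (ctranspose U ** R ** V) = norm R"
    using norm_unitary_mult U V unitary_ctranspose by metis
  finally show ?thesis by (simp add: R_def H_def power3_eq_cube mult_ac)
qed

theorem has_derivative_mat_powr_neg:
  fixes U :: "complex^'n^'n"
  assumes s: "0 < s" "s < 1" and U: "unitary U" and d: "\<And>i. 0 < d i"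
    and Z: "Z = U ** diagonal_mat d ** ctranspose U"
  shows "((\<lambda>Z. mat_powr Z (- s)) has_derivative neg_powr_derivative s U d) (at Z within {Z. pos_def Z})"
proof -
  \<comment> \<open>Half the smallest eigenvalue of \<open>Z\<close> bounds the eigenvalues of all matrices in the ball of this
    radius from below.\<close>
  define m where "m = Min (range d) / 2"
  have "\<And>i. Min (range d) \<le> d i" "Min (range d) > 0" using d by auto
  then have m: "m > 0" "\<And>i. 2 * m \<le> d i" by (auto simp: m_def)
  obtain L where L: "0 \<le> L" "\<And>a b c. m \<le> a \<Longrightarrow> m \<le> b \<Longrightarrow> m \<le> c \<Longrightarrow>
      \<bar>neg_power_kernel s a b - neg_power_kernel s a c\<bar> \<le> L * \<bar>b - c\<bar>"
    using neg_power_kernel_lipschitz[OF s m(1)] by blast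
  define c where "c = real (CARD('n))^3 * L"
  show ?thesis
  proof (rule has_derivativeI_sandwich[of m _ _ _ _ "\<lambda>Y. c * norm (Y - Z)"])
    show "bounded_linear (neg_powr_derivative s U d)"
      using linear_neg_powr_derivative by (simp add: linear_conv_bounded_linear)
    show "((\<lambda>Y. c * norm (Y - Z)) \<longlongrightarrow> 0) (at Z within {Z. pos_def Z})"
      by (auto intro!: tendsto_eq_intros)
    fix Y assume "Y \<in> {Z. pos_def Z}" and ne: "Y \<noteq> Z" and lt: "dist Y Z < m"
    then obtain V e where V: "unitary V" and Y: "Y = V ** diagonal_mat e ** ctranspose V"
      using pos_def_spectral by (metis mem_Collect_eq)
    have "m \<le> e j" for j
    proof -
      obtain k where "\<bar>e j - d k\<bar> \<le> norm (Y - Z)" using eigenvalue_perturbation[OF U V] Z Y by metis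
      then show ?thesis using lt m(2)[of k] unfolding dist_norm by linarith
    qed
    moreover have "m \<le> d i" for i using m(1) m(2)[of i] by linarith
    ultimately have "norm (mat_powr Y (- s) - mat_powr Z (- s) - neg_powr_derivative s U d (Y - Z))
        \<le> c * (norm (Y - Z))\<^sup>2"
      unfolding c_def by (intro neg_powr_remainder[OF U V _ _ m(1) L Z Y])
    then show "norm (mat_powr Y (- s) - mat_powr Z (- s) - neg_powr_derivative s U d (Y - Z)) / norm (Y - Z)
        \<le> c * norm (Y - Z)"
      using ne by (simp add: divide_le_eq power2_eq_square mult_ac)
  qed (rule m(1))
qed

section \<open>Gradient and Hessian of the trace function\<close>

lemma quad_form_congruence: "quad_form (E ** M ** ctranspose E) v = quad_form M (ctranspose E *v v)"
proof -
  have "quad_form (E ** M ** ctranspose E) v = cinner v (E *v (M *v (ctranspose E *v v)))"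
    by (simp add: quad_form_def cinner_def matrix_vector_mul_assoc matrix_mul_assoc)
  also have "\<dots> = cinner (ctranspose E *v v) (M *v (ctranspose E *v v))"
    by (rule cinner_matrix_mult)
  finally show ?thesis by (simp add: quad_form_def[of M] cinner_def)
qed

lemma pos_def_congruence:
  assumes "pos_def M" and inv: "E' ** ctranspose E = mat 1"
  shows "pos_def (E ** M ** ctranspose E)"
proof -
  have "ctranspose E *v v \<noteq> 0" if "v \<noteq> 0" for v
    using that inv by (metis matrix_vector_mul_assoc matrix_vector_mul_lid matrix_vector_mult_0_right)
  then show ?thesis
    using assms(1) by (simp add: pos_def_def hermitian_congruence quad_form_congruence)
qed

lemma norm_herm_mat: "norm (herm_mat X) = norm X"
  by (simp add: norm_eq_sqrt_inner inner_herm_mat)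

lemma open_PD: "open (PD :: 'n::finite herm set)"
  unfolding open_dist
proof
  fix X :: "'n herm" assume "X \<in> PD"
  then obtain r where "r > 0" and r: "\<And>Z'. hermitian Z' \<Longrightarrow> norm (Z' - herm_mat X) < r \<Longrightarrow> pos_def Z'"
    using pos_def_open_ball[of "herm_mat X"] by (auto simp: PD_def)
  have "Y \<in> PD" if "dist Y X < r" for Y
    using r[of "herm_mat Y"] that norm_herm_mat[of "Y - X"] by (simp add: PD_def dist_norm)
  then show "\<exists>e>0. \<forall>Y. dist Y X < e \<longrightarrow> Y \<in> PD" using \<open>r > 0\<close> by blast
qed

lemma bounded_linear_herm_mat: "bounded_linear (herm_mat :: 'n::finite herm \<Rightarrow> _)"
  by (rule linear_conv_bounded_linear[THEN iffD1]) (simp add: linear_iff)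

lemma bounded_linear_congruence: "bounded_linear (\<lambda>M. E ** M ** F)"
  for E :: "complex^'n^'m" and F :: "complex^'k^'l"
  by (rule linear_conv_bounded_linear[THEN iffD1])
     (simp add: linear_iff matrix_mult_add scaleR_matrix_mult)

text \<open>
  The orthogonal projection onto the Hermitian matrices. Unlike \<open>Herm\<close> it is linear on all
  matrices, which the chain rule needs.
\<close>

definition herm_part :: "complex^'n^'n \<Rightarrow> 'n herm" where
  "herm_part M = Herm ((1/2) *\<^sub>R (M + ctranspose M))"

lemma herm_mat_herm_part: "herm_mat (herm_part M) = (1/2) *\<^sub>R (M + ctranspose M)"
  unfolding herm_part_def
  by (rule herm_mat_Herm) (simp add: hermitian_def ctranspose_add ctranspose_scaleR add.commute)

lemma bounded_linear_herm_part: "bounded_linear (herm_part :: _ \<Rightarrow> 'n::finite herm)"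
  by (rule linear_conv_bounded_linear[THEN iffD1])
     (simp add: linear_iff herm_mat_inject[symmetric] herm_mat_herm_part ctranspose_add
       ctranspose_scaleR scaleR_add_right algebra_simps)

lemma inner_herm_part: "inner (herm_part M) Y = inner M (herm_mat Y)"
proof -
  have "inner (ctranspose M) (herm_mat Y) = inner M (herm_mat Y)"
    using inner_ctranspose[of M "herm_mat Y"] hermitian_ctranspose[of "herm_mat Y"] by simp
  then show ?thesis by (simp add: inner_herm_mat herm_mat_herm_part inner_add_left)
qed

lemma inner_congruence: "inner (E ** M ** F) N = inner M (ctranspose E ** N ** ctranspose F)"
  for M :: "complex^'n^'m"
  by (simp add: inner_mult_right[of "E ** M"] inner_mult_left[of E M] matrix_mul_assoc)

lemma inner_diagonal_mat: "inner (diagonal_mat d) N = (\<Sum>i\<in>UNIV. d i * Re (N $ i $ i))"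
proof -
  have "(\<Sum>j\<in>UNIV. inner (diagonal_mat d $ i $ j) (N $ i $ j)) = d i * Re (N $ i $ i)" for i
  proof -
    have "inner (diagonal_mat d $ i $ j) (N $ i $ j) = (if j = i then d i * Re (N $ i $ i) else 0)" for j
      by (simp add: diagonal_mat_def inner_complex_def)
    then show ?thesis by simp
  qed
  then show ?thesis by (simp add: inner_vec_def)
qed

lemma inner_neg_powr_derivative:
  "inner (neg_powr_derivative s U d H) N =
    - (\<Sum>i\<in>UNIV. \<Sum>j\<in>UNIV. neg_power_kernel s (d i) (d j) *
        inner ((ctranspose U ** H ** U) $ i $ j) ((ctranspose U ** N ** U) $ i $ j))"
proof -
  have "inner (complex_of_real r * z) w = r * inner z w" for r z w
    by (simp add: inner_complex_def algebra_simps)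
  then show ?thesis
    unfolding neg_powr_derivative_def inner_minus_left inner_congruence ctranspose_ctranspose
    by (simp add: inner_vec_def hadamard_def)
qed

text \<open>
  Writing \<open>tr Z\<^sup>1\<^sup>-\<^sup>s\<close> as \<open>\<langle>Z, Z\<^sup>-\<^sup>s\<rangle>\<close> reduces its derivative to that of the negative power.
\<close>

lemma trace_mat_powr_eq_inner:
  assumes "pos_def Z"
  shows "Re (trace (mat_powr Z (1 - s))) = inner Z (mat_powr Z (- s))"
proof -
  obtain U d where U: "unitary U" and d: "\<And>i. 0 < d i" and Z: "Z = U ** diagonal_mat d ** ctranspose U"
    using pos_def_spectral[OF assms] by blast
  have "diagonal_mat d ** diagonal_mat (\<lambda>i. d i powr - s) = diagonal_mat (\<lambda>i. d i powr (1 - s))"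
  proof -
    have "d i * d i powr - s = d i powr (1 - s)" for i
      using powr_mult_base[of "d i" "- s"] d[of i] by simp
    then show ?thesis
      by (simp only: vec_eq_iff diagonal_mat_mult) (auto simp: diagonal_mat_def simp flip: of_real_mult)
  qed
  then have "Z ** mat_powr Z (- s) = mat_powr Z (1 - s)"
    unfolding Z mat_powr_eq[OF U d] using U
    by (metis matrix_mul_assoc unitary_cancel(3))
  moreover have "hermitian Z" using assms by (simp add: pos_def_def)
  ultimately show ?thesis by (simp add: inner_eq_trace)
qed

text \<open>
  By the product rule the derivative is \<open>\<langle>H, Z\<^sup>-\<^sup>s\<rangle> + \<langle>Z, L H\<rangle>\<close> with \<open>L\<close> the derivative of the power.
  Only the diagonal of the kernel contributes to the second term, and
  \<open>k(d, d) = s d\<^sup>-\<^sup>s\<^sup>-\<^sup>1\<close> gives \<open>- s \<langle>Z\<^sup>-\<^sup>s, H\<rangle>\<close>.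
\<close>

lemma has_derivative_trace_mat_powr:
  fixes Z :: "complex^'n^'n"
  assumes s: "0 < s" "s < 1" and Z: "pos_def Z"
  shows "((\<lambda>Z. Re (trace (mat_powr Z (1 - s)))) has_derivative
    (\<lambda>H. (1 - s) * inner (mat_powr Z (- s)) H)) (at Z within {Z. pos_def Z})"
proof -
  obtain U d where U: "unitary U" and d: "\<And>i. 0 < d i" and ZU: "Z = U ** diagonal_mat d ** ctranspose U"
    using pos_def_spectral[OF Z] by blast
  have "((\<lambda>Z. inner Z (mat_powr Z (- s))) has_derivative
      (\<lambda>H. inner Z (neg_powr_derivative s U d H) + inner H (mat_powr Z (- s)))) (at Z within {Z. pos_def Z})"
    by (intro has_derivative_inner has_derivative_ident has_derivative_mat_powr_neg s U d ZU)
  also have "(\<lambda>H. inner Z (neg_powr_derivative s U d H) + inner H (mat_powr Z (- s)))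
     = (\<lambda>H. (1 - s) * inner (mat_powr Z (- s)) H)"
  proof
    fix H
    let ?h = "ctranspose U ** H ** U"
    have P: "inner (mat_powr Z (- s)) H = (\<Sum>i\<in>UNIV. d i powr - s * Re (?h $ i $ i))"
      unfolding ZU mat_powr_eq[OF U d] inner_congruence ctranspose_ctranspose inner_diagonal_mat ..
    have "inner Z (neg_powr_derivative s U d H)
       = inner (diagonal_mat d) (ctranspose U ** neg_powr_derivative s U d H ** U)"
      unfolding ZU inner_congruence ctranspose_ctranspose ..
    also have "ctranspose U ** neg_powr_derivative s U d H ** U
       = - hadamard (\<lambda>i j. neg_power_kernel s (d i) (d j)) ?h"
    proof -
      have neg: "A ** (- B) = - (A ** B)" "(- B) ** A = - (B ** A)" for A B :: "complex^'n^'n"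
        by (simp_all add: vec_eq_iff matrix_matrix_mult_def sum_negf)
      show ?thesis
        using U by (simp add: neg_powr_derivative_def neg unitary_cancel flip: matrix_mul_assoc)
    qed
    also have "inner (diagonal_mat d) (- hadamard (\<lambda>i j. neg_power_kernel s (d i) (d j)) ?h)
       = - (\<Sum>i\<in>UNIV. s * (d i powr - s * Re (?h $ i $ i)))"
    proof -
      have "d i * (s * d i powr (- s - 1)) = s * d i powr - s" for i
        using d[of i] by (simp add: powr_diff)
      then have "d i * Re (hadamard (\<lambda>i j. neg_power_kernel s (d i) (d j)) ?h $ i $ i)
          = s * (d i powr - s * Re (?h $ i $ i))" for i
        by (simp add: hadamard_def neg_power_kernel_def mult.assoc[symmetric])
      then show ?thesis by (simp add: inner_diagonal_mat sum_negf)
    qed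
    also have "\<dots> = - s * inner (mat_powr Z (- s)) H"
      by (simp add: P sum_distrib_left sum_negf)
    finally show "inner Z (neg_powr_derivative s U d H) + inner H (mat_powr Z (- s))
      = (1 - s) * inner (mat_powr Z (- s)) H"
      by (simp add: inner_commute[of H] left_diff_distrib)
  qed
  finally show ?thesis
    by (rule has_derivative_transform[rotated 2]) (simp_all add: trace_mat_powr_eq_inner Z)
qed

text \<open>
  The gradient is \<open>(1 - s) C Z\<^sup>-\<^sup>s C\<close> with \<open>Z = C X C\<close>, and it is differentiated with the chain
  rule.
\<close>

theorem hessian_trace_power:
  fixes C :: "complex^'n::finite^'n" and f :: "'n herm \<Rightarrow> real"
  assumes s: "0 < s" "s < 1" and C: "hermitian C" "C' ** C = mat 1"
    and f: "\<And>X. X \<in> PD \<Longrightarrow> f X = Re (trace (mat_powr (C ** herm_mat X ** C) (1 - s)))"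
    and X: "X \<in> PD" and U: "unitary U" and Z: "C ** herm_mat X ** C = U ** diagonal_mat d ** ctranspose U"
  shows "linear (hessian f X)"
    and "inner (hessian f X Y) W = - (1 - s) * (\<Sum>i\<in>UNIV. \<Sum>j\<in>UNIV. neg_power_kernel s (d i) (d j) *
        inner ((ctranspose U ** (C ** herm_mat Y ** C) ** U) $ i $ j)
          ((ctranspose U ** (C ** herm_mat W ** C) ** U) $ i $ j))"
proof -
  let ?c = "\<lambda>X. C ** herm_mat X ** C"
  have PD: "pos_def (?c X)" if "X \<in> PD" for X
    using pos_def_congruence[of "herm_mat X" C' C] that C by (simp add: PD_def hermitian_def)
  have d: "0 < d i" for i using PD[OF X] by (simp add: Z pos_def_spectral_iff[OF U])
  have lin: "bounded_linear ?c"
    by (rule bounded_linear_compose[OF bounded_linear_congruence bounded_linear_herm_mat])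
  have c: "(?c has_derivative ?c) (at X within PD)" for X
    by (rule bounded_linear.has_derivative[OF lin has_derivative_ident])
  define g where "g W = (1 - s) *\<^sub>R herm_part (C ** mat_powr (?c W) (- s) ** C)" for W
  have inner_g: "inner (herm_part (C ** M ** C)) Y = inner M (?c Y)" for M Y
    using C(1) by (simp add: inner_herm_part inner_congruence hermitian_def)
  have f': "(f has_derivative blinfun_inner_left (g W)) (at W)" if W: "W \<in> PD" for W
  proof -
    have "((\<lambda>X. Re (trace (mat_powr (?c X) (1 - s)))) has_derivative
        (\<lambda>Y. (1 - s) * inner (mat_powr (?c W) (- s)) (?c Y))) (at W within PD)"
      using PD W
      by (intro has_derivative_in_compose[OF c] has_derivative_subset[OF has_derivative_trace_mat_powr[OF s]])
         auto
    then have "((\<lambda>X. Re (trace (mat_powr (?c X) (1 - s)))) has_derivative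
        (\<lambda>Y. (1 - s) * inner (mat_powr (?c W) (- s)) (?c Y))) (at W)"
      using at_within_open[OF W open_PD] by simp
    then have "(f has_derivative (\<lambda>Y. (1 - s) * inner (mat_powr (?c W) (- s)) (?c Y))) (at W)"
      by (rule has_derivative_transform_within_open[OF _ open_PD W]) (simp add: f)
    moreover have "(\<lambda>Y. (1 - s) * inner (mat_powr (?c W) (- s)) (?c Y)) = blinfun_inner_left (g W)"
      by (rule ext) (simp add: g_def inner_g inner_commute[of _ "herm_part _"])
    ultimately show ?thesis by simp
  qed
  have "((\<lambda>W. mat_powr (?c W) (- s)) has_derivative (\<lambda>Y. neg_powr_derivative s U d (?c Y))) (at X within PD)"
    using PD
    by (intro has_derivative_in_compose[OF c] has_derivative_subset[OF has_derivative_mat_powr_neg[OF s U d Z]])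
       auto
  then have "((\<lambda>W. mat_powr (?c W) (- s)) has_derivative (\<lambda>Y. neg_powr_derivative s U d (?c Y))) (at X)"
    using at_within_open[OF X open_PD] by simp
  then have "((\<lambda>W. blinfun_inner_left (g W)) has_derivative
     (\<lambda>Y. blinfun_inner_left ((1 - s) *\<^sub>R herm_part (C ** neg_powr_derivative s U d (?c Y) ** C)))) (at X)"
    unfolding g_def
    by (intro bounded_linear.has_derivative[OF bounded_linear_blinfun_inner_left]
        bounded_linear.has_derivative[OF bounded_linear_scaleR_right]
        bounded_linear.has_derivative[OF bounded_linear_herm_part]
        bounded_linear.has_derivative[OF bounded_linear_congruence])
  from hessian_inner[OF open_PD X f' this] show "linear (hessian f X)"
    and "inner (hessian f X Y) W = - (1 - s) * (\<Sum>i\<in>UNIV. \<Sum>j\<in>UNIV. neg_power_kernel s (d i) (d j) *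
        inner ((ctranspose U ** (C ** herm_mat Y ** C) ** U) $ i $ j)
          ((ctranspose U ** (C ** herm_mat W ** C) ** U) $ i $ j))"
    by (simp_all add: inner_commute[of W "herm_part _"] inner_g inner_neg_powr_derivative left_diff_distrib)
qed

section \<open>Comparison of resolvents\<close>

lemma inner_spectral_bounds:
  fixes M :: "complex^'n^'n"
  assumes U: "unitary U" and c: "\<And>i. lo \<le> c i" "\<And>i. c i \<le> hi"
  shows "lo * (norm M)\<^sup>2 \<le> inner M ((U ** diagonal_mat c ** ctranspose U) ** M)"
    and "inner M ((U ** diagonal_mat c ** ctranspose U) ** M) \<le> hi * (norm M)\<^sup>2"
proof -
  define N where "N = ctranspose U ** M"
  have "inner M ((U ** diagonal_mat c ** ctranspose U) ** M) = inner N (diagonal_mat c ** N)"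
    by (simp add: N_def inner_mult_left[of "ctranspose U"] matrix_mul_assoc)
  also have "\<dots> = (\<Sum>i\<in>UNIV. \<Sum>j\<in>UNIV. c i * (norm (N $ i $ j))\<^sup>2)"
  proof -
    have "inner (N $ i $ j) ((diagonal_mat c ** N) $ i $ j) = c i * (norm (N $ i $ j))\<^sup>2" for i j
      by (simp add: diagonal_mat_mult inner_complex_def cmod_power2)
         (simp add: power2_eq_square algebra_simps)
    then show ?thesis by (simp add: inner_vec_def)
  qed
  finally have eq: "inner M ((U ** diagonal_mat c ** ctranspose U) ** M)
     = (\<Sum>i\<in>UNIV. \<Sum>j\<in>UNIV. c i * (norm (N $ i $ j))\<^sup>2)" .
  have "norm M = norm N" unfolding N_def using U by (simp add: norm_unitary_mult unitary_ctranspose)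
  then have nM: "r * (norm M)\<^sup>2 = (\<Sum>i\<in>UNIV. \<Sum>j\<in>UNIV. r * (norm (N $ i $ j))\<^sup>2)" for r
    by (simp add: power2_norm_eq_inner[of N] inner_vec_def sum_distrib_left power2_norm_eq_inner)
  show "lo * (norm M)\<^sup>2 \<le> inner M ((U ** diagonal_mat c ** ctranspose U) ** M)"
    "inner M ((U ** diagonal_mat c ** ctranspose U) ** M) \<le> hi * (norm M)\<^sup>2"
    unfolding eq nM using c by (auto intro!: sum_mono mult_right_mono)
qed

text \<open>
  A matrix and its adjoint have the same operator norm, here for the action on matrices by left
  multiplication.
\<close>

lemma norm_adjoint_mult_le:
  fixes E :: "complex^'n^'n" and M :: "complex^'k^'n"
  assumes P: "0 \<le> P" and E: "\<And>M :: complex^'k^'n. (norm (ctranspose E ** M))\<^sup>2 \<le> P * (norm M)\<^sup>2"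
  shows "(norm (E ** M))\<^sup>2 \<le> P * (norm M)\<^sup>2"
proof -
  have "(norm (E ** M))\<^sup>2 = inner M (ctranspose E ** (E ** M))"
    by (simp add: power2_norm_eq_inner inner_mult_left)
  also have "\<dots> \<le> norm M * norm (ctranspose E ** (E ** M))"
    by (rule norm_cauchy_schwarz)
  finally have "((norm (E ** M))\<^sup>2)\<^sup>2 \<le> (norm M * norm (ctranspose E ** (E ** M)))\<^sup>2"
    by (intro power_mono) auto
  also have "\<dots> \<le> (norm M)\<^sup>2 * (P * (norm (E ** M))\<^sup>2)"
    using E[of "E ** M"] by (simp add: power_mult_distrib mult_left_mono)
  finally have le: "(norm (E ** M))\<^sup>2 * (norm (E ** M))\<^sup>2 \<le> (P * (norm M)\<^sup>2) * (norm (E ** M))\<^sup>2"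
    by (simp add: power2_eq_square mult_ac)
  show ?thesis
  proof (cases "E ** M = 0")
    case False
    then have "0 < (norm (E ** M))\<^sup>2" by simp
    with le show ?thesis by (rule mult_right_le_imp_le)
  qed (use P in simp)
qed

text \<open>
  With \<open>E = (B\<^sup>*)\<inverse>\<close> one has \<open>Y = E (B\<^sup>* Y B) E\<^sup>*\<close>. The hypotheses bound \<open>E\<close> by \<open>sqrt P\<close> and \<open>B\<close>
  by \<open>1 / sqrt p\<close> in operator norm, and both factors occur twice.
\<close>

lemma congruence_norm_bounds:
  fixes E B Y :: "complex^'n^'n"
  assumes EB: "ctranspose E ** B = mat 1" and p: "0 < p" "0 \<le> P"
    and E: "\<And>M :: complex^'n^'n. p * (norm M)\<^sup>2 \<le> (norm (ctranspose E ** M))\<^sup>2"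
      "\<And>M :: complex^'n^'n. (norm (ctranspose E ** M))\<^sup>2 \<le> P * (norm M)\<^sup>2"
  shows "(norm Y)\<^sup>2 \<le> P\<^sup>2 * (norm (ctranspose B ** Y ** B))\<^sup>2"
    and "p\<^sup>2 * (norm (ctranspose B ** Y ** B))\<^sup>2 \<le> (norm Y)\<^sup>2"
proof -
  have BE: "B ** ctranspose E = mat 1" using EB by (simp add: matrix_left_right_inverse)
  have EB': "E ** ctranspose B = mat 1"
    using BE by (metis ctranspose_ctranspose ctranspose_mult EB hermitian_ctranspose hermitian_closure(2))
  have left: "(norm (E ** M))\<^sup>2 \<le> P * (norm M)\<^sup>2" for M :: "complex^'n^'n"
    by (rule norm_adjoint_mult_le[OF p(2) E(2)])
  have right: "(norm (M ** ctranspose E))\<^sup>2 \<le> P * (norm M)\<^sup>2" for M :: "complex^'n^'n"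
    using left[of "ctranspose M"] norm_ctranspose[of "M ** ctranspose E"] by (simp add: ctranspose_mult)
  let ?N = "ctranspose B ** Y ** B"
  have "E ** ?N ** ctranspose E = (E ** ctranspose B) ** Y ** (B ** ctranspose E)"
    by (simp add: matrix_mul_assoc)
  then have Y: "E ** ?N ** ctranspose E = Y" by (simp add: EB' BE)
  have "(norm (E ** ?N ** ctranspose E))\<^sup>2 \<le> P * (P * (norm ?N)\<^sup>2)"
    using right[of "E ** ?N"] left[of ?N] p(2) by (meson mult_left_mono order_trans)
  then show "(norm Y)\<^sup>2 \<le> P\<^sup>2 * (norm ?N)\<^sup>2"
    unfolding Y by (simp add: power2_eq_square mult_ac)
  have Bp: "(norm (B ** M))\<^sup>2 \<le> (1/p) * (norm M)\<^sup>2" for M :: "complex^'n^'n"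
    using E(1)[of "B ** M"] p(1) by (simp add: matrix_mul_assoc EB field_simps)
  have left': "(norm (ctranspose B ** M))\<^sup>2 \<le> (1/p) * (norm M)\<^sup>2" for M :: "complex^'n^'n"
    by (rule norm_adjoint_mult_le) (use p Bp in simp_all)
  have right': "(norm (M ** B))\<^sup>2 \<le> (1/p) * (norm M)\<^sup>2" for M :: "complex^'n^'n"
    using left'[of "ctranspose M"] norm_ctranspose[of "M ** B"] by (simp add: ctranspose_mult)
  have "(norm ?N)\<^sup>2 \<le> (1/p) * ((1/p) * (norm Y)\<^sup>2)"
    using right'[of "ctranspose B ** Y"] left'[of Y] p(1)
    by (meson mult_left_mono order_trans zero_le_divide_1_iff less_imp_le)
  then show "p\<^sup>2 * (norm ?N)\<^sup>2 \<le> (norm Y)\<^sup>2"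
    using p(1) by (simp add: power2_eq_square field_simps)
qed

text \<open>
  With \<open>B = C U (l + diag(d))\<^sup>-\<^sup>1\<^sup>/\<^sup>2\<close> the sum \<open>S Y\<close> is \<open>\<parallel>B\<^sup>* Y B\<parallel>\<^sup>2\<close>, and \<open>B B\<^sup>* = C (l + Z)\<inverse> C\<close>. The
  adjoint inverse \<open>E\<close> of \<open>B\<close> satisfies \<open>E E\<^sup>* = C\<inverse> (l + Z) C\<inverse> = l C\<^sup>-\<^sup>2 + X\<close>. This sum is bounded
  by the bounds for \<open>C\<inverse>\<close> and \<open>X\<close>, which do not involve the eigenvalues of \<open>Z\<close>.
\<close>

lemma resolvent_congruence_bounds:
  fixes C C' :: "complex^'n^'n"
  assumes C: "hermitian C" "C' ** C = mat 1"
    and C': "\<And>M :: complex^'n^'n. q * (norm M)\<^sup>2 \<le> (norm (C' ** M))\<^sup>2"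
      "\<And>M :: complex^'n^'n. (norm (C' ** M))\<^sup>2 \<le> Q * (norm M)\<^sup>2"
    and X: "\<And>M :: complex^'n^'n. \<alpha> * (norm M)\<^sup>2 \<le> inner M (X ** M)"
      "\<And>M :: complex^'n^'n. inner M (X ** M) \<le> \<beta> * (norm M)\<^sup>2"
    and pos: "0 \<le> q" "0 \<le> Q" "0 < \<alpha>" "0 < \<beta>" and l: "0 < l"
    and U: "unitary U" and d: "\<And>i. 0 < d i" and Z: "C ** X ** C = U ** diagonal_mat d ** ctranspose U"
  defines "S \<equiv> \<lambda>Y. (\<Sum>i\<in>UNIV. \<Sum>j\<in>UNIV.
      (norm ((ctranspose U ** (C ** Y ** C) ** U) $ i $ j))\<^sup>2 / ((l + d i) * (l + d j)))"
  shows "(norm Y)\<^sup>2 / (l * Q + \<beta>)\<^sup>2 \<le> S Y" and "S Y \<le> (norm Y)\<^sup>2 / (l * q + \<alpha>)\<^sup>2"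
proof -
  \<comment> \<open>The square root splits the weight \<open>1 / ((l + d i) (l + d j))\<close> into a left and a right factor.\<close>
  define D where "D = diagonal_mat (\<lambda>i. 1 / sqrt (l + d i))"
  define D' where "D' = diagonal_mat (\<lambda>i. sqrt (l + d i))"
  have ld: "l + d i \<noteq> 0" for i using d[of i] l by linarith
  have D'D: "D' ** D = mat 1" and D'D': "D' ** D' = diagonal_mat (\<lambda>i. l + d i)"
    using d l by (auto simp: vec_eq_iff D'_def diagonal_mat_mult)
       (auto simp: D_def diagonal_mat_def mat_def ld add_pos_pos less_imp_le simp flip: of_real_mult)
  have CC': "C ** C' = mat 1" using C(2) by (simp add: matrix_left_right_inverse)
  have herm: "ctranspose C = C" "ctranspose C' = C'"
  proof -
    show "ctranspose C = C" using C(1) by (simp add: hermitian_def)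
    then have "C ** ctranspose C' = mat 1"
      using C(2) by (metis ctranspose_mult hermitian_ctranspose hermitian_closure(2))
    then show "ctranspose C' = C'" using C(2) by (metis matrix_mul_assoc matrix_mul_lid matrix_mul_rid)
  qed
  define B where "B = C ** U ** D"
  define E where "E = C' ** U ** D'"
  have ctE: "ctranspose E = D' ** ctranspose U ** C'"
    by (simp add: E_def D'_def ctranspose_mult herm matrix_mul_assoc)
  have EB: "ctranspose E ** B = mat 1"
  proof -
    have "ctranspose E ** B = D' ** (ctranspose U ** ((C' ** C) ** (U ** D)))"
      by (simp add: ctE B_def flip: matrix_mul_assoc)
    then show ?thesis by (simp add: C(2) D'D unitary_cancel[OF U])
  qed
  have EE: "E ** ctranspose E = l *\<^sub>R (C' ** C') + X"
  proof -
    have "diagonal_mat (\<lambda>i. l + d i) = l *\<^sub>R mat 1 + diagonal_mat d"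
      by (simp add: diagonal_mat_def mat_def vec_eq_iff of_real_def scaleR_add_left)
    then have shift: "U ** (D' ** D') ** ctranspose U = l *\<^sub>R mat 1 + C ** X ** C"
      by (simp add: D'D' matrix_mult_add scaleR_matrix_mult Z unitary_cancel[OF U])
    have "E ** ctranspose E = C' ** (U ** (D' ** D') ** ctranspose U) ** C'"
      unfolding ctE by (simp add: E_def matrix_mul_assoc)
    also note shift
    also have "C' ** (l *\<^sub>R mat 1 + C ** X ** C) ** C' = l *\<^sub>R (C' ** C') + (C' ** C) ** X ** (C ** C')"
      by (simp add: matrix_mult_add scaleR_matrix_mult matrix_mul_assoc)
    finally show ?thesis by (simp add: C(2) CC')
  qed
  have nE: "(norm (ctranspose E ** M))\<^sup>2 = l * (norm (C' ** M))\<^sup>2 + inner M (X ** M)" for M :: "complex^'n^'n"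
  proof -
    have "(norm (ctranspose E ** M))\<^sup>2 = inner M ((E ** ctranspose E) ** M)"
      by (simp add: power2_norm_eq_inner inner_mult_left[of "ctranspose E"] matrix_mul_assoc)
    also have "\<dots> = l * inner M (C' ** (C' ** M)) + inner M (X ** M)"
      by (simp add: EE matrix_mult_add scaleR_matrix_mult inner_add_right matrix_mul_assoc)
    also have "inner M (C' ** (C' ** M)) = (norm (C' ** M))\<^sup>2"
      by (simp add: power2_norm_eq_inner inner_mult_left[of C'] herm)
    finally show ?thesis .
  qed
  have bounds: "(l * q + \<alpha>) * (norm M)\<^sup>2 \<le> (norm (ctranspose E ** M))\<^sup>2"
    "(norm (ctranspose E ** M))\<^sup>2 \<le> (l * Q + \<beta>) * (norm M)\<^sup>2" for M :: "complex^'n^'n"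
    unfolding nE distrib_right mult.assoc using l by (intro add_mono mult_left_mono C' X; simp)+
  have S: "S Y = (norm (ctranspose B ** Y ** B))\<^sup>2" for Y
  proof -
    let ?N = "ctranspose U ** (C ** Y ** C) ** U"
    have "ctranspose B ** Y ** B = D ** ?N ** D"
      by (simp add: B_def D_def ctranspose_mult herm matrix_mul_assoc)
    then have "(norm (ctranspose B ** Y ** B))\<^sup>2 = (\<Sum>i\<in>UNIV. \<Sum>j\<in>UNIV. (norm ((D ** ?N ** D) $ i $ j))\<^sup>2)"
      by (simp only: power2_norm_eq_inner inner_vec_def)
    also have "\<dots> = S Y"
      unfolding S_def using d l
      by (intro sum.cong refl)
         (simp add: D_def diagonal_mat_mult norm_mult norm_divide power_mult_distrib power_divide
           add_pos_pos less_imp_le)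
    finally show ?thesis by simp
  qed
  have p: "0 < l * q + \<alpha>" "0 < l * Q + \<beta>" using pos l by (simp_all add: add_nonneg_pos)
  show "(norm Y)\<^sup>2 / (l * Q + \<beta>)\<^sup>2 \<le> S Y"
    using congruence_norm_bounds(1)[OF EB p(1) less_imp_le[OF p(2)] bounds, of Y] p(2)
    by (simp add: S divide_le_eq mult.commute)
  show "S Y \<le> (norm Y)\<^sup>2 / (l * q + \<alpha>)\<^sup>2"
    using congruence_norm_bounds(2)[OF EB p(1) less_imp_le[OF p(2)] bounds, of Y] p(1)
    by (simp add: S le_divide_eq mult.commute)
qed

section \<open>The condition number\<close>

text \<open>
  The lower bound of the form makes \<open>T\<close> injective with \<open>\<parallel>T\<inverse>\<parallel> \<le> 1 / lo\<close>. Symmetry enters through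
  the Cauchy--Schwarz inequality for the form of \<open>- T\<close>, which yields \<open>\<parallel>T\<parallel> \<le> hi\<close>.
\<close>

lemma condition_number_le:
  fixes T :: "'a::euclidean_space \<Rightarrow> 'a"
  assumes lin: "linear T" and sym: "\<And>x y. inner x (T y) = inner y (T x)"
    and lo: "0 < lo" "\<And>x. lo * (norm x)\<^sup>2 \<le> inner x (- T x)"
    and hi: "\<And>x. inner x (- T x) \<le> hi * (norm x)\<^sup>2"
  shows "condition_number T \<le> ereal (hi / lo)"
proof -
  have neg: "linear (\<lambda>x. - T x)" using lin by (rule linear_compose_neg)
  have lower: "lo * norm x \<le> norm (T x)" for x
  proof -
    have "lo * (norm x)\<^sup>2 \<le> norm x * norm (T x)"
      using lo(2)[of x] norm_cauchy_schwarz[of x "- T x"] by simp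
    then show ?thesis by (cases "x = 0") (simp_all add: power2_eq_square mult_ac)
  qed
  obtain b :: 'a where b: "norm b = 1" using vector_choose_size[of 1] by auto
  have hi0: "0 \<le> hi" using lo(1) order_trans[OF lo(2) hi, of b] b by simp
  have nonneg: "0 \<le> inner x (- T x)" for x
    using lo(1) by (intro order_trans[OF _ lo(2)]) simp
  have upper: "norm (T x) \<le> hi * norm x" for x
  proof (cases "T x = 0")
    case False
    have "(inner (T x) (- T x))\<^sup>2 \<le> inner (T x) (- T (T x)) * inner x (- T x)"
      by (rule psd_form_Cauchy_Schwarz[OF neg subspace_UNIV _ nonneg]) (simp_all add: sym)
    also have "\<dots> \<le> (hi * (norm (T x))\<^sup>2) * (hi * (norm x)\<^sup>2)"
      using hi0 by (intro mult_mono hi nonneg) simp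
    finally have "(norm (T x))\<^sup>2 * (norm (T x))\<^sup>2 \<le> (hi * norm x)\<^sup>2 * (norm (T x))\<^sup>2"
      by (simp add: power2_norm_eq_inner[symmetric] power2_eq_square[of "(norm (T x))\<^sup>2"] power_mult_distrib mult_ac)
        (simp add: power2_eq_square mult_ac)
    then have "(norm (T x))\<^sup>2 \<le> (hi * norm x)\<^sup>2"
      using False by (elim mult_right_le_imp_le) simp
    then show ?thesis using hi0 by (simp add: power2_le_iff_abs_le)
  qed (use hi0 in simp)
  have "inj T"
    unfolding linear_injective_0[OF lin]
  proof (intro allI impI)
    fix x assume "T x = 0"
    with lower[of x] lo(1) show "x = 0" by (simp add: mult_le_0_iff)
  qed
  then have bij: "bij T" using linear_injective_imp_surjective[OF lin] by (simp add: bij_def)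
  have "onorm T \<le> hi" by (rule onorm_le) (rule upper)
  moreover have "onorm (inv T) \<le> 1 / lo"
  proof (rule onorm_le)
    fix y
    have "T (inv T y) = y" using bij by (simp add: bij_is_surj surj_f_inv_f)
    with lower[of "inv T y"] show "norm (inv T y) \<le> 1 / lo * norm y"
      using lo(1) by (simp add: field_simps)
  qed
  moreover have "0 \<le> onorm (inv T)"
  proof -
    have "linear (inv T)" using lin bij by (simp add: inj_linear_imp_inv_linear bij_is_inj)
    then show ?thesis by (simp add: onorm_pos_le linear_conv_bounded_linear)
  qed
  ultimately have "onorm T * onorm (inv T) \<le> hi * (1 / lo)"
    using hi0 by (intro mult_mono) auto
  then show ?thesis using bij by (simp add: condition_number_def)
qed

lemma mat_powr_mult_bounds:
  fixes A M :: "complex^'n^'n"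
  assumes A: "pos_def A" and b: "0 < \<alpha>" "\<alpha> *\<^sub>R mat 1 \<preceq> A" "A \<preceq> \<beta> *\<^sub>R mat 1" and r: "0 \<le> r"
  shows "(\<beta> powr - (2 * r)) * (norm M)\<^sup>2 \<le> (norm (mat_powr A (- r) ** M))\<^sup>2"
    and "(norm (mat_powr A (- r) ** M))\<^sup>2 \<le> (\<alpha> powr - (2 * r)) * (norm M)\<^sup>2"
    and "hermitian (mat_powr A r)" "mat_powr A (- r) ** mat_powr A r = mat 1"
proof -
  obtain U a where U: "unitary U" and a: "\<And>i. 0 < a i" and AU: "A = U ** diagonal_mat a ** ctranspose U"
    using pos_def_spectral[OF A] by blast
  have ab: "\<alpha> \<le> a i" "a i \<le> \<beta>" for i
    using b loewner_eigenvalue_bounds[OF U] unfolding AU by blast+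
  have pw: "mat_powr A x = U ** diagonal_mat (\<lambda>i. a i powr x) ** ctranspose U" for x
    unfolding AU by (rule mat_powr_eq[OF U a])
  show "hermitian (mat_powr A r)" unfolding pw by (rule hermitian_spectral_form)
  have mult: "mat_powr A x ** mat_powr A y = mat_powr A (x + y)" for x y
  proof -
    have "diagonal_mat (\<lambda>i. a i powr x) ** diagonal_mat (\<lambda>i. a i powr y) = diagonal_mat (\<lambda>i. a i powr (x + y))"
      by (simp only: vec_eq_iff diagonal_mat_mult) (auto simp: diagonal_mat_def powr_add)
    then show ?thesis unfolding pw using U by (metis matrix_mul_assoc unitary_cancel(3))
  qed
  have "mat_powr A 0 = mat 1"
    using scalar_spectral_form[OF U, of 1] a by (simp add: pw less_imp_neq[symmetric])
  then show "mat_powr A (- r) ** mat_powr A r = mat 1" by (simp add: mult)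
  have "(norm (mat_powr A (- r) ** M))\<^sup>2 = inner M (mat_powr A (- r) ** (mat_powr A (- r) ** M))"
    unfolding power2_norm_eq_inner inner_mult_left
    by (simp add: hermitian_ctranspose pw hermitian_spectral_form)
  also have "\<dots> = inner M ((U ** diagonal_mat (\<lambda>i. a i powr - (2 * r)) ** ctranspose U) ** M)"
    unfolding matrix_mul_assoc mult by (simp add: pw)
  finally have eq: "(norm (mat_powr A (- r) ** M))\<^sup>2
     = inner M ((U ** diagonal_mat (\<lambda>i. a i powr - (2 * r)) ** ctranspose U) ** M)" .
  have "\<beta> powr - (2 * r) \<le> a i powr - (2 * r)" "a i powr - (2 * r) \<le> \<alpha> powr - (2 * r)" for i
    using ab[of i] a[of i] b(1) r by (auto intro!: powr_mono2')
  from inner_spectral_bounds[OF U this, of M]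
  show "(\<beta> powr - (2 * r)) * (norm M)\<^sup>2 \<le> (norm (mat_powr A (- r) ** M))\<^sup>2"
    and "(norm (mat_powr A (- r) ** M))\<^sup>2 \<le> (\<alpha> powr - (2 * r)) * (norm M)\<^sup>2"
    by (simp_all add: eq)
qed

text \<open>
  The value of \<open>c \<integral> l\<^sup>-\<^sup>s / (l Q + y)\<^sup>2 dl\<close>, with \<open>c\<close> the normalizing constant of the integral
  representation and \<open>Q\<close> the scalar \<open>C\<^sup>-\<^sup>2\<close> for the \<open>1 \<times> 1\<close> matrix \<open>A = x\<close>. Up to the factor \<open>1 - s\<close>
  it is the negative second derivative at \<open>y\<close> of the scalar function \<open>y \<mapsto> x\<^sup>s y\<^sup>1\<^sup>-\<^sup>s\<close>.
\<close>

lemma neg_power_kernel_scaled_value: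
  assumes "0 < x" "0 < y" "0 < s" "s < 1"
  defines "Q \<equiv> x powr - (s / (1 - s))"
  shows "1 / Q\<^sup>2 * neg_power_kernel s (y / Q) (y / Q) = s * x powr s * y powr (- s - 1)"
proof -
  have Q: "Q > 0" "Q = x powr - (s / (1 - s))" using assms by (simp_all add: Q_def)
  have "1 / Q\<^sup>2 * neg_power_kernel s (y / Q) (y / Q) = s * (Q powr (s - 1)) * y powr (- s - 1)"
  proof -
    have "(y / Q) powr (- s - 1) = y powr (- s - 1) * Q powr (s + 1)"
      using Q(1) assms(2) by (simp add: powr_divide powr_minus_divide powr_diff powr_add)
    moreover have "Q powr (s + 1) = Q\<^sup>2 * Q powr (s - 1)"
      using Q(1) by (simp add: powr_add powr_diff power2_eq_square)
    ultimately show ?thesis using Q(1) by (simp add: neg_power_kernel_def)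
  qed
  also have "Q powr (s - 1) = x powr s"
  proof -
    have "- (s / (1 - s)) * (s - 1) = s" using assms(4) by (simp add: field_simps)
    then show ?thesis by (simp only: Q(2) powr_powr)
  qed
  finally show ?thesis by simp
qed

theorem corollary2:
  fixes A :: "'n::finite herm" and t \<alpha> \<beta> :: real
    and f :: "'n herm \<Rightarrow> real" and K :: "'n herm set"
  assumes "A \<in> PD" and "0 < t" and "t < 1"
    and "\<And>X. X \<in> PD \<Longrightarrow>
      f X = Re (trace (mat_powr
        (mat_powr (herm_mat A) ((1 - t) / (2 * t)) ** herm_mat X **
         mat_powr (herm_mat A) ((1 - t) / (2 * t))) t))"
    and "K \<subseteq> PD" and "compact K" and "convex K"
    and "0 < \<alpha>" and "0 < \<beta>"
    and "\<And>Y. Y \<in> K \<union> {A} \<Longrightarrow> \<alpha> *\<^sub>R mat 1 \<preceq> herm_mat Y \<and> herm_mat Y \<preceq> \<beta> *\<^sub>R mat 1"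
    and "X \<in> K"
  shows "condition_number (hessian f X) \<le> ereal ((\<beta> / \<alpha>) powr (3 - 2 * t))"
proof -
  define s where "s = 1 - t"
  have s: "0 < s" "s < 1" using assms(2,3) by (simp_all add: s_def)
  define r where "r = (1 - t) / (2 * t)"
  have r: "0 \<le> r" "2 * r = s / (1 - s)" using assms(2,3) by (simp_all add: r_def s_def field_simps)
  define C where "C = mat_powr (herm_mat A) r"
  define C' where "C' = mat_powr (herm_mat A) (- r)"
  have X: "X \<in> PD" using assms(5,11) by blast
  have A: "pos_def (herm_mat A)" using assms(1) by (simp add: PD_def)
  have LA: "\<alpha> *\<^sub>R mat 1 \<preceq> herm_mat A" "herm_mat A \<preceq> \<beta> *\<^sub>R mat 1"
    and LX: "\<alpha> *\<^sub>R mat 1 \<preceq> herm_mat X" "herm_mat X \<preceq> \<beta> *\<^sub>R mat 1"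
    using assms(10)[of A] assms(10)[of X] assms(11) by auto
  note Cb = mat_powr_mult_bounds[OF A assms(8) LA r(1), folded C_def C'_def]
  have f: "f X = Re (trace (mat_powr (C ** herm_mat X ** C) (1 - s)))" if "X \<in> PD" for X
    using assms(4)[OF that] by (simp add: C_def r_def s_def)
  have Zpd: "pos_def (C ** herm_mat X ** C)"
    using pos_def_congruence[of "herm_mat X" C' C] X Cb(3,4) by (simp add: PD_def hermitian_def)
  then obtain U d where U: "unitary U" and d: "\<And>i. 0 < d i"
    and Z: "C ** herm_mat X ** C = U ** diagonal_mat d ** ctranspose U"
    using pos_def_spectral by blast
  note H = hessian_trace_power[OF s Cb(3,4) f X U Z]
  have Xb: "\<alpha> * (norm M)\<^sup>2 \<le> inner M (herm_mat X ** M)" "inner M (herm_mat X ** M) \<le> \<beta> * (norm M)\<^sup>2"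
    for M :: "complex^'n^'n"
  proof -
    obtain V e where V: "unitary V" and e: "herm_mat X = V ** diagonal_mat e ** ctranspose V"
      using hermitian_spectral[OF hermitian_herm_mat] by blast
    have "\<And>i. \<alpha> \<le> e i" "\<And>i. e i \<le> \<beta>"
      using LX loewner_eigenvalue_bounds[OF V] unfolding e by blast+
    from inner_spectral_bounds[OF V this, of M]
    show "\<alpha> * (norm M)\<^sup>2 \<le> inner M (herm_mat X ** M)" "inner M (herm_mat X ** M) \<le> \<beta> * (norm M)\<^sup>2"
      by (simp_all add: e)
  qed
  define y where "y Y i j = (ctranspose U ** (C ** herm_mat Y ** C) ** U) $ i $ j" for Y i j
  define S where "S Y = (\<Sum>i\<in>UNIV. \<Sum>j\<in>UNIV. (norm (y Y i j))\<^sup>2 * neg_power_kernel s (d i) (d j))" for Y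
  have HS: "inner Y (- hessian f X Y) = (1 - s) * S Y" for Y
    using H(2)[of Y Y]
    by (simp add: S_def y_def inner_commute[of Y] power2_norm_eq_inner mult.commute left_diff_distrib)
  have sym: "inner Y (hessian f X W) = inner W (hessian f X Y)" for Y W
    using H(2)[of W Y] H(2)[of Y W] by (simp add: inner_commute)
  define q where "q = \<beta> powr - (2 * r)"
  define Q where "Q = \<alpha> powr - (2 * r)"
  have qQ: "0 < q" "0 < Q" using assms(8,9) by (simp_all add: q_def Q_def)
  have b: "(norm Y)\<^sup>2 / (l * Q + \<beta>)\<^sup>2 \<le> (\<Sum>i\<in>UNIV. \<Sum>j\<in>UNIV. (norm (y Y i j))\<^sup>2 / ((l + d i) * (l + d j)))"
    "(\<Sum>i\<in>UNIV. \<Sum>j\<in>UNIV. (norm (y Y i j))\<^sup>2 / ((l + d i) * (l + d j))) \<le> (norm Y)\<^sup>2 / (l * q + \<alpha>)\<^sup>2"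
    if "0 < l" for l Y
    using resolvent_congruence_bounds[OF Cb(3,4,1,2) Xb _ _ assms(8,9) that U d Z, of "herm_mat Y"]
    by (simp_all add: y_def q_def Q_def norm_herm_mat)
  \<comment> \<open>Dividing by \<open>R\<^sup>2\<close> brings the scalar bounds into the form of the kernel integrand, as sums with
    a single term.\<close>
  have sc: "(norm Y)\<^sup>2 / (l * R + z)\<^sup>2 = (\<Sum>j\<in>{()}. ((norm Y)\<^sup>2 / R\<^sup>2) / ((l + z / R) * (l + z / R)))"
    if "0 < R" for l R z and Y :: "'n herm"
  proof -
    have "R * (l + z / R) = l * R + z" using that by (simp add: field_simps)
    then have "R\<^sup>2 * ((l + z / R) * (l + z / R)) = (l * R + z)\<^sup>2"
      by (simp add: power2_eq_square flip: mult.assoc) (metis mult.assoc mult.commute)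
    then show ?thesis by simp
  qed
  \<comment> \<open>The kernel comparison is for sums over one index, so double sums become sums over pairs.\<close>
  have pr: "(\<Sum>i\<in>UNIV. \<Sum>j\<in>UNIV. g i j) = (\<Sum>p\<in>UNIV. g (fst p) (snd p))" for g :: "'n \<Rightarrow> 'n \<Rightarrow> real"
    by (simp add: sum.cartesian_product case_prod_beta)
  have L: "(\<Sum>j\<in>{()}. ((norm Y)\<^sup>2 / Q\<^sup>2) * neg_power_kernel s (\<beta> / Q) (\<beta> / Q)) \<le> S Y" for Y
    unfolding S_def pr
    by (rule neg_power_kernel_sum_mono[OF s])
       (use d qQ assms(8,9) b(1)[of _ Y] in \<open>simp_all add: sc pr del: sum.insert sum.empty\<close>)
  have R: "S Y \<le> (\<Sum>j\<in>{()}. ((norm Y)\<^sup>2 / q\<^sup>2) * neg_power_kernel s (\<alpha> / q) (\<alpha> / q))" for Y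
    unfolding S_def pr
    by (rule neg_power_kernel_sum_mono[OF s])
       (use d qQ assms(8,9) b(2)[of _ Y] in \<open>simp_all add: sc pr del: sum.insert sum.empty\<close>)
  have vQ: "1 / Q\<^sup>2 * neg_power_kernel s (\<beta> / Q) (\<beta> / Q) = s * \<alpha> powr s * \<beta> powr (- s - 1)"
    and vq: "1 / q\<^sup>2 * neg_power_kernel s (\<alpha> / q) (\<alpha> / q) = s * \<beta> powr s * \<alpha> powr (- s - 1)"
    unfolding Q_def q_def r(2)
    by (rule neg_power_kernel_scaled_value[OF assms(8,9) s], rule neg_power_kernel_scaled_value[OF assms(9,8) s])
  have Sb: "(s * \<alpha> powr s * \<beta> powr (- s - 1)) * (norm Y)\<^sup>2 \<le> S Y"
    "S Y \<le> (s * \<beta> powr s * \<alpha> powr (- s - 1)) * (norm Y)\<^sup>2" for Y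
    using L[of Y] R[of Y] unfolding vQ[symmetric] vq[symmetric] by (simp_all add: mult.commute)
  define lo where "lo = (1 - s) * (s * \<alpha> powr s * \<beta> powr (- s - 1))"
  define hi where "hi = (1 - s) * (s * \<beta> powr s * \<alpha> powr (- s - 1))"
  have "condition_number (hessian f X) \<le> ereal (hi / lo)"
  proof (rule condition_number_le[OF H(1) sym])
    show "0 < lo" using s assms(8,9) by (simp add: lo_def)
    show "lo * (norm Y)\<^sup>2 \<le> inner Y (- hessian f X Y)" for Y
      unfolding HS lo_def mult.assoc[of "1 - s"] using s by (intro mult_left_mono Sb) simp
    show "inner Y (- hessian f X Y) \<le> hi * (norm Y)\<^sup>2" for Y
      unfolding HS hi_def mult.assoc[of "1 - s"] using s by (intro mult_left_mono Sb) simp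
  qed
  also have "hi / lo = (\<beta> / \<alpha>) powr (3 - 2 * t)"
  proof -
    have "hi / lo = (\<beta> powr s / \<beta> powr (- s - 1)) * (\<alpha> powr (- s - 1) / \<alpha> powr s)"
      using s by (simp add: hi_def lo_def)
    also have "\<dots> = \<beta> powr (2 * s + 1) * \<alpha> powr - (2 * s + 1)"
      by (simp flip: powr_diff)
    also have "\<dots> = (\<beta> / \<alpha>) powr (2 * s + 1)"
      unfolding powr_minus_divide using assms(8,9) by (simp add: powr_divide)
    finally show ?thesis by (simp add: s_def algebra_simps)
  qed
  finally show ?thesis .
qed

end
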